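(* Let $\mathbf f:\mathbb R^m\to\mathbb R^m$ be a flux such that for every $\mathbf u\in\mathbb R^m$ the Jacobian matrix $\mathbf f'(\mathbf u)$ is diagonalizable with real eigenvalues, let $\lambda>0$ be a constant, and let $S_2(\cdot)$ be the over-relaxation scheme operator defined in the context. Let $\mathbf w$ and $\mathbf z$ (functions of $x\in\mathbb R$ and of time $t$, with values in $\mathbb R^m$) be smooth solutions of the time marching algorithm $$\frac{1}{\Delta t}\begin{pmatrix}\mathbf w(\cdot,t+\frac{\Delta t}{2})-\mathbf w(\cdot,t-\frac{\Delta t}{2})\\ \mathbf z(\cdot,t+\frac{\Delta t}{2})-\mathbf z(\cdot,t-\frac{\Delta t}{2})\end{pmatrix}=\frac{1}{\Delta t}\Big(S_2\big(\tfrac{\Delta t}{2}\big)-S_2\big(-\tfrac{\Delta t}{2}\big)\Big)\begin{pmatrix}\mathbf w(\cdot,t)\\ \mathbf z(\cdot,t)\end{pmatrix}.$$ Define the flux error $\mathbf y:=\mathbf z-\mathbf f(\mathbf w)$. Then, up to second order terms in $\Delta t$, $\mathbf w$ and $\mathbf y$ are solutions of the following (non conservative) hyperbolic system of conservation laws: $$\partial_t\begin{pmatrix}\mathbf w\\ \mathbf y\end{pmatrix}+\begin{pmatrix}\mathbf f'(\mathbf w)&0\\0&-\mathbf f'(\mathbf w)\end{pmatrix}\partial_x\begin{pmatrix}\mathbf w\\ \mathbf y\end{pmatrix}=0.$$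
   Context: The scheme is meant to approximate the system of conservation laws $\partial_t\mathbf u+\partial_x\mathbf f(\mathbf u)=0$ with unknown $\mathbf u(x,t)\in\mathbb R^m$, posed on the whole line $x\in\mathbb R$ (no boundaries). Here $\mathbf w$ plays the role of the approximation of $\mathbf u$ and $\mathbf z$ that of the approximation of the flux $\mathbf f(\mathbf u)$. All operators act on pairs $(\mathbf w,\mathbf z)$ of functions of $x\in\mathbb R$ with values in $\mathbb R^m$; products of operators denote composition. For a (positive or negative) time $s$, the translation operator is $(\tau(s)\mathbf v)(x)=\mathbf v(x-\lambda s)$. Free transport operator: $$T(s)=\frac12\begin{pmatrix}\tau(s)+\tau(-s)&(\tau(s)-\tau(-s))/\lambda\\ \lambda(\tau(s)-\tau(-s))&\tau(s)+\tau(-s)\end{pmatrix},$$ which gives the solution after time $s$ of $\partial_t\mathbf w+\partial_x\mathbf z=0$, $\partial_t\mathbf z+\lambda^2\partial_x\mathbf w=0$. Over-relaxation operator (nonlinear in general, applied pointwise in $x$): $$R_0\begin{pmatrix}\mathbf w\\ \mathbf z\end{pmatrix}=\begin{pmatrix}\mathbf w\\ 2\mathbf f(\mathbf w)-\mathbf z\end{pmatrix}.$$ Over-relaxation scheme: $$S_2(s)=T\big(\tfrac s4\big)\,R_0\,T\big(\tfrac s2\big)\,R_0\,T\big(\tfrac s4\big),$$ which satisfies $S_2(0)=I$ (the identity) and $S_2(-s)=S_2(s)^{-1}$. The difference $S_2(\frac{\Delta t}{2})-S_2(-\frac{\Delta t}{2})$ applied to a pair means the difference of the images of that pair. The result is a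 (formal) equivalent equation: "up to second order terms in $\Delta t$" refers to the Taylor expansion, as $\Delta t$ tends to zero, of both sides of the time marching algorithm, in which the first order terms in $\Delta t$ vanish by symmetry and terms of order $O(\Delta t^2)$ are dropped.
   Formalization: The flux f is assumed smooth, and w, z are families of solutions indexed by Δt → 0 whose derivatives of order at most 3 are bounded uniformly in Δt on compact sets; "up to second order terms" means the residual is O(Δt²) uniformly on compact sets. *)

theory Defs
  imports "HOL-Analysis.Analysis"
begin

primrec iter_deriv ::
  "'a list \<Rightarrow> ('a::real_normed_vector \<Rightarrow> 'b::real_normed_vector) \<Rightarrow> 'a \<Rightarrow> 'b" where
  "iter_deriv [] g = g"
| "iter_deriv (v # vs) g = iter_deriv vs (\<lambda>p. frechet_derivative g (at p) v)"

text \<open>On an open set \<open>D\<close> of a finite-dimensional space this is \<open>C\<^sup>\<infinity>\<close>: every iterated directional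
  derivative exists and is differentiable, hence continuous.\<close>

definition smooth_on ::
  "'a::real_normed_vector set \<Rightarrow> ('a \<Rightarrow> 'b::real_normed_vector) \<Rightarrow> bool" where
  "smooth_on D g \<longleftrightarrow> (\<forall>vs. \<forall>p\<in>D. iter_deriv vs g differentiable (at p))"

text \<open>\<open>g h p = O(r h)\<close> as \<open>h\<close> tends to \<open>0\<close> from above, uniformly for \<open>p\<close> in compact subsets of \<open>D\<close>.\<close>

definition locally_uniform_bigo ::
  "'a::topological_space set \<Rightarrow> (real \<Rightarrow> 'a \<Rightarrow> 'b::real_normed_vector) \<Rightarrow> (real \<Rightarrow> real) \<Rightarrow> bool" where
  "locally_uniform_bigo D g r \<longleftrightarrow>
     (\<forall>K. compact K \<and> K \<subseteq> D \<longrightarrow>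
        (\<exists>C. \<forall>\<^sub>F h in at_right 0. \<forall>p\<in>K. norm (g h p) \<le> C * \<bar>r h\<bar>))"

text \<open>All matrices involved are real, so "diagonalizable with real eigenvalues" means similar over
  the reals to a diagonal matrix.\<close>

definition real_diagonalizable :: "real^'n^'n \<Rightarrow> bool" where
  "real_diagonalizable A \<longleftrightarrow>
     (\<exists>(P::real^'n^'n) (D::real^'n^'n).
        invertible P \<and> (\<forall>i j. i \<noteq> j \<longrightarrow> D $ i $ j = 0) \<and>
        A = P ** D ** matrix_inv P)"

definition hyperbolic :: "(real^'n \<Rightarrow> real^'n^'n) \<Rightarrow> bool" where
  "hyperbolic M \<longleftrightarrow> (\<forall>U. real_diagonalizable (M U))"

text \<open>Points are pairs \<open>(x, t)\<close>; the value is \<open>\<partial>\<^sub>t U + M(U) \<partial>\<^sub>x U\<close>.\<close>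

definition system_residual ::
  "(real^'n \<Rightarrow> real^'n^'n) \<Rightarrow> (real \<times> real \<Rightarrow> real^'n) \<Rightarrow> real \<times> real \<Rightarrow> real^'n" where
  "system_residual M U = (\<lambda>(x, t).
     vector_derivative (\<lambda>s. U (x, s)) (at t)
     + M (U (x, t)) *v vector_derivative (\<lambda>\<xi>. U (\<xi>, t)) (at x))"

text \<open>Block vectors and matrices are indexed by the sum type \<open>'m + 'm\<close>.\<close>

definition stack :: "real^'m \<Rightarrow> real^'m \<Rightarrow> real^('m + 'm)" where
  "stack a b = (\<chi> i. case i of Inl j \<Rightarrow> a $ j | Inr j \<Rightarrow> b $ j)"

definition upper :: "real^('m + 'm) \<Rightarrow> real^'m" where
  "upper U = (\<chi> j. U $ Inl j)"

definition block_diag :: "real^'m^'m \<Rightarrow> real^'m^'m \<Rightarrow> real^('m + 'm)^('m + 'm)" where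
  "block_diag A B = (\<chi> i j. case (i, j) of
       (Inl k, Inl l) \<Rightarrow> A $ k $ l
     | (Inr k, Inr l) \<Rightarrow> B $ k $ l
     | _ \<Rightarrow> 0)"

definition flux_error ::
  "(real^'m \<Rightarrow> real^'m) \<Rightarrow> (real \<times> real \<Rightarrow> real^'m) \<Rightarrow> (real \<times> real \<Rightarrow> real^'m) \<Rightarrow>
   real \<times> real \<Rightarrow> real^'m" where
  "flux_error f w z p = z p - f (w p)"

definition flux_error_matrix ::
  "(real^'m \<Rightarrow> real^'m) \<Rightarrow> real^('m + 'm) \<Rightarrow> real^('m + 'm)^('m + 'm)" where
  "flux_error_matrix f U =
     block_diag (jacobian f (at (upper U))) (- jacobian f (at (upper U)))"

type_synonym 'm fields = "(real \<Rightarrow> real^'m) \<times> (real \<Rightarrow> real^'m)"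

definition translation :: "real \<Rightarrow> real \<Rightarrow> (real \<Rightarrow> real^'m) \<Rightarrow> real \<Rightarrow> real^'m" where
  "translation lam s v = (\<lambda>x. v (x - lam * s))"

definition transport :: "real \<Rightarrow> real \<Rightarrow> ('m::finite) fields \<Rightarrow> 'm fields" where
  "transport lam s = (\<lambda>(w, z).
     (\<lambda>x. (1/2) *\<^sub>R (translation lam s w x + translation lam (- s) w x
            + (1 / lam) *\<^sub>R (translation lam s z x - translation lam (- s) z x)),
      \<lambda>x. (1/2) *\<^sub>R (lam *\<^sub>R (translation lam s w x - translation lam (- s) w x)
            + (translation lam s z x + translation lam (- s) z x))))"

definition over_relaxation :: "(real^'m \<Rightarrow> real^'m) \<Rightarrow> ('m::finite) fields \<Rightarrow> 'm fields" where
  "over_relaxation f = (\<lambda>(w, z). (w, \<lambda>x. 2 *\<^sub>R f (w x) - z x))"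

definition scheme2 :: "real \<Rightarrow> (real^'m \<Rightarrow> real^'m) \<Rightarrow> real \<Rightarrow> ('m::finite) fields \<Rightarrow> 'm fields" where
  "scheme2 lam f s =
     transport lam (s / 4) \<circ> over_relaxation f \<circ> transport lam (s / 2)
       \<circ> over_relaxation f \<circ> transport lam (s / 4)"

definition time_slice ::
  "(real \<times> real \<Rightarrow> real^'m) \<Rightarrow> (real \<times> real \<Rightarrow> real^'m) \<Rightarrow> real \<Rightarrow> ('m::finite) fields" where
  "time_slice w z t = ((\<lambda>x. w (x, t)), (\<lambda>x. z (x, t)))"

text \<open>\<open>h\<close> is the time step \<open>\<Delta>t\<close>. The fields are meant on \<open>UNIV \<times> J\<close>, so the equation is required only at
  those times \<open>t\<close> for which \<open>t\<close> and \<open>t \<plusminus> h/2\<close> belong to \<open>J\<close>.\<close>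

definition solves_time_marching ::
  "real \<Rightarrow> (real^'m \<Rightarrow> real^'m) \<Rightarrow> real set \<Rightarrow> real \<Rightarrow>
   (real \<times> real \<Rightarrow> real^'m) \<Rightarrow> (real \<times> real \<Rightarrow> real^'m) \<Rightarrow> bool" where
  "solves_time_marching lam f J h w z \<longleftrightarrow>
     (\<forall>x t. t - h/2 \<in> J \<and> t \<in> J \<and> t + h/2 \<in> J \<longrightarrow>
        (1 / h) *\<^sub>R (w (x, t + h/2) - w (x, t - h/2))
          = (1 / h) *\<^sub>R (fst (scheme2 lam f (h/2) (time_slice w z t)) x
                       - fst (scheme2 lam f (- (h/2)) (time_slice w z t)) x) \<and>
        (1 / h) *\<^sub>R (z (x, t + h/2) - z (x, t - h/2))
          = (1 / h) *\<^sub>R (snd (scheme2 lam f (h/2) (time_slice w z t)) x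
                       - snd (scheme2 lam f (- (h/2)) (time_slice w z t)) x))"

end

theory Submission
  imports Defs
begin

text \<open>
  Write \<open>\<sigma> = \<Delta>t/2\<close>. Both sides of the scheme are central differences, in which the even Taylor terms
  cancel, so only the first-order coefficients have to be compared, with an error \<open>O(\<sigma>\<^sup>3)\<close>.
  On the right this coefficient is computed by pushing first-order jets through the factors of \<open>S\<^sub>2\<close>:
  since \<open>R\<^sub>0\<close> is an involution, the derivative of \<open>S\<^sub>2\<close> at \<open>0\<close> sends \<open>(w, z)\<close> to
  \<open>(- f'(w) w\<^sub>x, f'(w) (z\<^sub>x - 2 f'(w) w\<^sub>x))\<close>. Combining the two components gives
  \<open>y\<^sub>t = z\<^sub>t - f'(w) w\<^sub>t = f'(w) (z\<^sub>x - f'(w) w\<^sub>x) = f'(w) y\<^sub>x\<close> up to \<open>O(\<Delta>t\<^sup>2)\<close>.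
\<close>

subsection \<open>Iterated derivatives\<close>

text \<open>The fields \<open>w h\<close> and \<open>z h\<close> change with the time step, so a
  Taylor expansion of one fixed solution says nothing about the limit: its remainder must be bounded
  by one constant for all small \<open>h\<close> and all points of a compact set. For this reason
  expansions are stated for indexed families, and every bound on derivatives is tracked explicitly.
  Bounds up to order three suffice, since a central difference leaves a remainder of order
  \<open>h^3\<close> and division by \<open>h\<close> turns it into \<open>h^2\<close>. The
  nonlinearity acts between translations, so intermediate fields must be expanded at moving points.
  Keeping the expansion along all lines \<open>x + k s\<close> at once makes a translation a mere
  change of the slope \<open>k\<close>, while \<open>R_0\<close> becomes a composition with
  \<open>f\<close> on each line. The equation for \<open>y\<close> is not obtained by a direct
  expansion of \<open>y\<close>: it is a combination of the defects of the \<open>w\<close> and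
  \<open>z\<close> equations, and this needs a bound on \<open>f'(w)\<close> uniform in
  \<open>h\<close>.\<close>

lemma iter_deriv_snoc:
  "iter_deriv (vs @ [v]) g p = frechet_derivative (iter_deriv vs g) (at p) v"
  by (induction vs arbitrary: g) auto

text \<open>The recursion of \<open>iter_deriv\<close> consumes the innermost direction at the head
  of the list, so a further, outermost derivative is appended at the end.\<close>

lemma iter_deriv_has_derivative:
  assumes "smooth_on D g" "p \<in> D"
  shows "(iter_deriv vs g has_derivative (\<lambda>v. iter_deriv (vs @ [v]) g p)) (at p)"
  using assms by (simp add: iter_deriv_snoc smooth_on_def frechet_derivative_works[symmetric])

lemma smooth_on_frechet_derivative:
  assumes "smooth_on D g"
  shows "smooth_on D (\<lambda>p. frechet_derivative g (at p) v)"
  unfolding smooth_on_def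
proof (intro allI ballI)
  fix vs p assume "p \<in> D"
  then have "iter_deriv (v # vs) g differentiable (at p)"
    using assms unfolding smooth_on_def by blast
  then show "iter_deriv vs (\<lambda>p. frechet_derivative g (at p) v) differentiable (at p)" by simp
qed

lemma frechet_derivative_smooth:
  assumes "smooth_on D g" "p \<in> D"
  shows "(g has_derivative frechet_derivative g (at p)) (at p)"
  using iter_deriv_has_derivative[OF assms, of "[]"] by (simp add: iter_deriv_snoc)

lemma linear_frechet_derivative_smooth:
  assumes "smooth_on D g" "p \<in> D"
  shows "linear (frechet_derivative g (at p))"
  using frechet_derivative_smooth[OF assms] by (rule has_derivative_linear)

text \<open>Serves the expansion of a direction in the basis: the coefficients do not depend on the
  point, so all later derivatives pass through the sum.\<close>

lemma iter_deriv_linear_combination: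
  assumes "finite S" "\<And>b. b \<in> S \<Longrightarrow> smooth_on UNIV (g b)"
  shows "iter_deriv vs (\<lambda>p. \<Sum>b\<in>S. c b *\<^sub>R g b p)
    = (\<lambda>p. \<Sum>b\<in>S. c b *\<^sub>R iter_deriv vs (g b) p)"
  using assms(2)
proof (induction vs arbitrary: g)
  case Nil
  then show ?case by simp
next
  case (Cons v vs)
  have "((\<lambda>p. \<Sum>b\<in>S. c b *\<^sub>R g b p) has_derivative
      (\<lambda>v. \<Sum>b\<in>S. c b *\<^sub>R frechet_derivative (g b) (at p) v)) (at p)" for p
    by (intro has_derivative_sum has_derivative_scaleR_right frechet_derivative_smooth[of UNIV])
      (use Cons.prems in auto)
  then have "frechet_derivative (\<lambda>p. \<Sum>b\<in>S. c b *\<^sub>R g b p) (at p)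
      = (\<lambda>v. \<Sum>b\<in>S. c b *\<^sub>R frechet_derivative (g b) (at p) v)" for p
    by (rule frechet_derivative_at[symmetric])
  then show ?case
    by (simp add: Cons.IH smooth_on_frechet_derivative Cons.prems)
qed

text \<open>Smoothness speaks of one list of directions at a time, whereas the bound must hold for
  all directions at once. Expanding the innermost direction in the finite basis reduces it to
  finitely many smooth functions with one derivative less, hence the induction on \<open>n\<close>
  for arbitrary \<open>f\<close>.\<close>

lemma iter_deriv_bounded_on_compact:
  fixes f :: "'a::euclidean_space \<Rightarrow> 'b::real_normed_vector"
  assumes "smooth_on UNIV f" "compact C"
  shows "\<exists>M\<ge>0. \<forall>u\<in>C. \<forall>vs. length vs = n \<longrightarrow>
      norm (iter_deriv vs f u) \<le> M * prod_list (map norm vs)"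
  using assms(1)
proof (induction n arbitrary: f)
  case 0
  have "continuous_on C f"
    using has_derivative_continuous[OF frechet_derivative_smooth[OF 0 UNIV_I]]
    by (intro continuous_at_imp_continuous_on) blast
  then have "bounded (f ` C)"
    using assms(2) compact_continuous_image compact_imp_bounded by blast
  then obtain M where "\<forall>u\<in>C. norm (f u) \<le> M" unfolding bounded_iff by auto
  \<comment> \<open>For empty \<open>C\<close> the bound \<open>M\<close> may be negative.\<close>
  then have "\<forall>u\<in>C. norm (f u) \<le> max M 0" by force
  then show ?case by (intro exI[of _ "max M 0"]) auto
next
  case (Suc n)
  let ?g = "\<lambda>b p. frechet_derivative f (at p) b"
  have sm: "smooth_on UNIV (?g b)" for b
    using Suc.prems by (rule smooth_on_frechet_derivative)
  obtain M where M: "\<And>b. M b \<ge> 0" "\<And>b u vs. u \<in> C \<Longrightarrow> length vs = n \<Longrightarrow>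
      norm (iter_deriv vs (?g b) u) \<le> M b * prod_list (map norm vs)"
    using Suc.IH[OF sm] by metis
  have "norm (iter_deriv (v # vs) f u) \<le> (\<Sum>b\<in>Basis. M b) * prod_list (map norm (v # vs))"
    if "u \<in> C" "length vs = n" for u v and vs :: "'a list"
  proof -
    have "?g v p = (\<Sum>b\<in>Basis. (v \<bullet> b) *\<^sub>R ?g b p)" for p
    proof -
      have "linear (frechet_derivative f (at p))"
        using linear_frechet_derivative_smooth[OF Suc.prems] by auto
      then have "frechet_derivative f (at p) (\<Sum>b\<in>Basis. (v \<bullet> b) *\<^sub>R b)
          = (\<Sum>b\<in>Basis. (v \<bullet> b) *\<^sub>R ?g b p)"
        by (simp add: linear_sum linear_cmul)
      then show ?thesis by (simp add: euclidean_representation)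
    qed
    then have "iter_deriv (v # vs) f u = (\<Sum>b\<in>Basis. (v \<bullet> b) *\<^sub>R iter_deriv vs (?g b) u)"
      using iter_deriv_linear_combination[of Basis ?g vs "\<lambda>b. v \<bullet> b"] sm by simp
    also have "norm \<dots> \<le> (\<Sum>b\<in>Basis. norm v * (M b * prod_list (map norm vs)))"
      using M(2)[OF that] by (intro sum_norm_le) (auto intro!: mult_mono Basis_le_norm)
    also have "\<dots> = (\<Sum>b\<in>Basis. M b) * prod_list (map norm (v # vs))"
      by (simp add: sum_distrib_right sum_distrib_left mult_ac)
    finally show ?thesis .
  qed
  then show ?case
    by (intro exI[of _ "\<Sum>b\<in>Basis. M b"]) (auto simp: M(1) sum_nonneg length_Suc_conv)
qed

text \<open>Allows the quadratic Taylor term to be multiplied out. Linearity in the second direction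
  is that of a derivative; in the first it comes from differentiating the pointwise linearity of
  \<open>frechet_derivative f (at p)\<close>.\<close>

lemma bilinear_second_derivative:
  assumes "smooth_on UNIV f"
  shows "bilinear (\<lambda>v v'. iter_deriv [v, v'] f u)"
proof -
  note lin = linear_frechet_derivative_smooth[OF assms UNIV_I]
  note D = frechet_derivative_smooth[OF smooth_on_frechet_derivative[OF assms] UNIV_I]
  have 1: "frechet_derivative (\<lambda>p. frechet_derivative f (at p) (v + v')) (at u)
    = (\<lambda>x. frechet_derivative (\<lambda>p. frechet_derivative f (at p) v) (at u) x
      + frechet_derivative (\<lambda>p. frechet_derivative f (at p) v') (at u) x)" for v v'
    by (rule frechet_derivative_at[symmetric])
      (use has_derivative_add[OF D[of v] D[of v']] in \<open>simp add: linear_add[OF lin]\<close>)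
  have 2: "frechet_derivative (\<lambda>p. frechet_derivative f (at p) (c *\<^sub>R v)) (at u)
    = (\<lambda>x. c *\<^sub>R frechet_derivative (\<lambda>p. frechet_derivative f (at p) v) (at u) x)" for c v
    by (rule frechet_derivative_at[symmetric])
      (use has_derivative_scaleR_right[OF D[of v]] in \<open>simp add: linear_cmul[OF lin]\<close>)
  have 3: "linear (frechet_derivative (\<lambda>p. frechet_derivative f (at p) v) (at u))" for v
    using D by (rule has_derivative_linear)
  show ?thesis
    unfolding bilinear_def by (auto intro!: linearI simp: 1 2 linear_add[OF 3] linear_cmul[OF 3])
qed

text \<open>The Lagrange form of the remainder fails for vector values. The scalar theorem is
  therefore applied to the inner product of \<open>g\<close> along the line with the remainder
  vector \<open>X\<close> itself; Cauchy-Schwarz then bounds the square of \<open>norm X\<close> by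
  \<open>norm X\<close> times the desired bound.\<close>

lemma taylor_line:
  fixes g :: "'a::real_normed_vector \<Rightarrow> 'b::real_inner"
  assumes smooth: "smooth_on D g"
    and line: "\<And>\<theta>. \<bar>\<theta>\<bar> \<le> \<bar>s\<bar> \<Longrightarrow> p + \<theta> *\<^sub>R v \<in> D"
    and bound: "\<And>\<theta>. \<bar>\<theta>\<bar> \<le> \<bar>s\<bar> \<Longrightarrow> norm (iter_deriv [v, v, v] g (p + \<theta> *\<^sub>R v)) \<le> B"
  shows "norm (g (p + s *\<^sub>R v) - g p - s *\<^sub>R iter_deriv [v] g p
      - s\<^sup>2 *\<^sub>R ((1/2) *\<^sub>R iter_deriv [v, v] g p)) \<le> B * \<bar>s\<bar> ^ 3"
proof (cases "s = 0")
  case True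
  then show ?thesis by simp
next
  case False
  let ?D = "\<lambda>m \<theta>. iter_deriv (replicate m v) g (p + \<theta> *\<^sub>R v)"
  define X where "X = g (p + s *\<^sub>R v) - g p - s *\<^sub>R iter_deriv [v] g p
      - s\<^sup>2 *\<^sub>R ((1/2) *\<^sub>R iter_deriv [v, v] g p)"
  have der: "((\<lambda>\<theta>. X \<bullet> ?D m \<theta>) has_real_derivative X \<bullet> ?D (Suc m) \<theta>) (at \<theta>)"
    if "\<bar>\<theta>\<bar> \<le> \<bar>s\<bar>" for m \<theta>
  proof -
    have *: "((\<lambda>\<theta>. ?D m \<theta>) has_derivative
        (\<lambda>x. iter_deriv (replicate m v @ [x *\<^sub>R v]) g (p + \<theta> *\<^sub>R v))) (at \<theta>)"
      by (rule has_derivative_compose[where g = "iter_deriv (replicate m v) g"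
              and f = "\<lambda>\<theta>. p + \<theta> *\<^sub>R v" and f' = "\<lambda>x. x *\<^sub>R v"])
        (auto intro!: derivative_eq_intros iter_deriv_has_derivative[OF smooth] line that)
    have lin: "linear (\<lambda>v'. iter_deriv (replicate m v @ [v']) g (p + \<theta> *\<^sub>R v))"
      using iter_deriv_has_derivative[OF smooth line[OF that]] has_derivative_linear by blast
    have "iter_deriv (replicate m v @ [x *\<^sub>R v]) g (p + \<theta> *\<^sub>R v) = x *\<^sub>R ?D (Suc m) \<theta>" for x
      using linear_cmul[OF lin, of x v] by (simp add: replicate_append_same)
    with * have "((\<lambda>\<theta>. ?D m \<theta>) has_derivative (\<lambda>x. x *\<^sub>R ?D (Suc m) \<theta>)) (at \<theta>)" by simp
    then have "((\<lambda>\<theta>. X \<bullet> ?D m \<theta>) has_derivative (\<lambda>x. X \<bullet> (x *\<^sub>R ?D (Suc m) \<theta>))) (at \<theta>)"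
      by (rule has_derivative_inner_right)
    then show ?thesis by (simp add: has_field_derivative_def mult_commute_abs mult.commute)
  qed
  \<comment> \<open>The interval from \<open>-\<bar>s\<bar>\<close> to \<open>\<bar>s\<bar>\<close>
    contains the base point 0 and \<open>s\<close> for either sign of \<open>s\<close>.\<close>
  have "\<exists>t. (if s < 0 then s < t \<and> t < 0 else 0 < t \<and> t < s) \<and>
      X \<bullet> ?D 0 s = (\<Sum>m<3. (X \<bullet> ?D m 0) / fact m * (s - 0) ^ m)
        + (X \<bullet> ?D 3 t) / fact 3 * (s - 0) ^ 3"
    by (rule Taylor[where a = "-\<bar>s\<bar>" and b = "\<bar>s\<bar>"]) (use False der in auto)
  then obtain t where *: "if s < 0 then s < t \<and> t < 0 else 0 < t \<and> t < s"
    and eq: "X \<bullet> ?D 0 s = (\<Sum>m<3. (X \<bullet> ?D m 0) / fact m * s ^ m)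
        + (X \<bullet> ?D 3 t) / fact 3 * s ^ 3"
    unfolding diff_zero by blast
  from * have t: "\<bar>t\<bar> \<le> \<bar>s\<bar>" by (auto split: if_splits)
  have "norm X * norm X = X \<bullet> X" by (simp add: norm_eq_sqrt_inner)
  \<comment> \<open>Only one factor of \<open>X \<bullet> X\<close> is unfolded; the other remains
    the fixed test vector. The Taylor polynomial then cancels exactly what \<open>X\<close>
    subtracts from \<open>g\<close>.\<close>
  also have "\<dots> = (X \<bullet> ?D 3 t) / 6 * s ^ 3"
    using eq by (subst (2) X_def)
      (simp add: numeral_3_eq_3 lessThan_Suc inner_simps fact_numeral power2_eq_square algebra_simps)
  also have "\<dots> \<le> \<bar>X \<bullet> ?D 3 t\<bar> * \<bar>s\<bar> ^ 3"
  proof -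
    have "(X \<bullet> ?D 3 t) / 6 * s ^ 3 \<le> \<bar>(X \<bullet> ?D 3 t) / 6 * s ^ 3\<bar>" by (rule abs_ge_self)
    also have "\<dots> \<le> \<bar>X \<bullet> ?D 3 t\<bar> * \<bar>s\<bar> ^ 3"
      by (simp add: abs_mult power_abs)
    finally show ?thesis .
  qed
  also have "\<dots> \<le> (norm X * B) * \<bar>s\<bar> ^ 3"
  proof -
    have "\<bar>X \<bullet> ?D 3 t\<bar> \<le> norm X * norm (?D 3 t)" by (rule Cauchy_Schwarz_ineq2)
    also have "\<dots> \<le> norm X * B"
      using bound[OF t] by (intro mult_left_mono) (auto simp: numeral_3_eq_3)
    finally show ?thesis by (intro mult_right_mono) auto
  qed
  finally have "norm X * norm X \<le> norm X * (B * \<bar>s\<bar> ^ 3)" by (simp add: mult_ac)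
  \<comment> \<open>Covers \<open>norm X = 0\<close>, where the factor \<open>norm X\<close> cannot
    be cancelled.\<close>
  moreover have "0 \<le> B * \<bar>s\<bar> ^ 3"
    using order_trans[OF norm_ge_zero bound[OF t]] by simp
  ultimately have "norm X \<le> B * \<bar>s\<bar> ^ 3"
    by (metis mult_le_cancel_left_pos norm_ge_zero order_le_less)
  then show ?thesis by (simp add: X_def)
qed

subsection \<open>Uniform second-order expansions\<close>

text \<open>The quadratic coefficient \<open>r\<close> is not tracked, only bounded, because central differences cancel it.
  All constants are uniform in the index \<open>i\<close>, which later is \<open>(h, x, t)\<close>.\<close>

definition expands ::
  "'i set \<Rightarrow> ('i \<Rightarrow> real \<Rightarrow> 'b::real_normed_vector) \<Rightarrow> ('i \<Rightarrow> 'b) \<Rightarrow> ('i \<Rightarrow> 'b) \<Rightarrow> bool" where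
  "expands I g p q \<longleftrightarrow> (\<exists>B r \<delta>. 0 \<le> B \<and> 0 < \<delta> \<and> \<delta> \<le> 1 \<and>
     (\<forall>i\<in>I. norm (p i) \<le> B \<and> norm (q i) \<le> B \<and> norm (r i) \<le> B \<and>
       (\<forall>s. \<bar>s\<bar> \<le> \<delta> \<longrightarrow> norm (g i s - p i - s *\<^sub>R q i - s\<^sup>2 *\<^sub>R r i) \<le> B * \<bar>s\<bar> ^ 3)))"

lemma expandsE:
  assumes "expands I g p q"
  obtains B r \<delta> where "0 \<le> B" "0 < \<delta>" "\<delta> \<le> 1"
    "\<And>i. i \<in> I \<Longrightarrow> norm (p i) \<le> B" "\<And>i. i \<in> I \<Longrightarrow> norm (q i) \<le> B" "\<And>i. i \<in> I \<Longrightarrow> norm (r i) \<le> B"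
    "\<And>i s. i \<in> I \<Longrightarrow> \<bar>s\<bar> \<le> \<delta> \<Longrightarrow>
      norm (g i s - p i - s *\<^sub>R q i - s\<^sup>2 *\<^sub>R r i) \<le> B * \<bar>s\<bar> ^ 3"
  using assms unfolding expands_def by blast

lemma expands_add:
  assumes "expands I g p q" "expands I g' p' q'"
  shows "expands I (\<lambda>i s. g i s + g' i s) (\<lambda>i. p i + p' i) (\<lambda>i. q i + q' i)"
proof -
  obtain B r \<delta> where 1: "0 \<le> B" "0 < \<delta>" "\<delta> \<le> 1"
    "\<And>i. i \<in> I \<Longrightarrow> norm (p i) \<le> B" "\<And>i. i \<in> I \<Longrightarrow> norm (q i) \<le> B" "\<And>i. i \<in> I \<Longrightarrow> norm (r i) \<le> B"
    "\<And>i s. i \<in> I \<Longrightarrow> \<bar>s\<bar> \<le> \<delta> \<Longrightarrow>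
      norm (g i s - p i - s *\<^sub>R q i - s\<^sup>2 *\<^sub>R r i) \<le> B * \<bar>s\<bar> ^ 3"
    using assms(1) by (rule expandsE) blast
  obtain B' r' \<delta>' where 2: "0 \<le> B'" "0 < \<delta>'" "\<delta>' \<le> 1"
    "\<And>i. i \<in> I \<Longrightarrow> norm (p' i) \<le> B'" "\<And>i. i \<in> I \<Longrightarrow> norm (q' i) \<le> B'"
    "\<And>i. i \<in> I \<Longrightarrow> norm (r' i) \<le> B'"
    "\<And>i s. i \<in> I \<Longrightarrow> \<bar>s\<bar> \<le> \<delta>' \<Longrightarrow>
      norm (g' i s - p' i - s *\<^sub>R q' i - s\<^sup>2 *\<^sub>R r' i) \<le> B' * \<bar>s\<bar> ^ 3"
    using assms(2) by (rule expandsE) blast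
  have "norm (g i s + g' i s - (p i + p' i) - s *\<^sub>R (q i + q' i) - s\<^sup>2 *\<^sub>R (r i + r' i))
      \<le> (B + B') * \<bar>s\<bar> ^ 3" if "i \<in> I" "\<bar>s\<bar> \<le> min \<delta> \<delta>'" for i s
  proof -
    have "g i s + g' i s - (p i + p' i) - s *\<^sub>R (q i + q' i) - s\<^sup>2 *\<^sub>R (r i + r' i)
      = (g i s - p i - s *\<^sub>R q i - s\<^sup>2 *\<^sub>R r i) + (g' i s - p' i - s *\<^sub>R q' i - s\<^sup>2 *\<^sub>R r' i)"
      by (simp add: algebra_simps)
    also have "norm \<dots> \<le> B * \<bar>s\<bar> ^ 3 + B' * \<bar>s\<bar> ^ 3"
      using 1(7)[of i s] 2(7)[of i s] that by (intro norm_triangle_mono) auto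
    finally show ?thesis by (simp add: distrib_right)
  qed
  then show ?thesis
    unfolding expands_def using 1 2
    by (intro exI[of _ "B + B'"] exI[of _ "\<lambda>i. r i + r' i"] exI[of _ "min \<delta> \<delta>'"])
      (auto intro!: norm_triangle_mono)
qed

lemma expands_scaleR:
  assumes "expands I g p q"
  shows "expands I (\<lambda>i s. c *\<^sub>R g i s) (\<lambda>i. c *\<^sub>R p i) (\<lambda>i. c *\<^sub>R q i)"
proof -
  obtain B r \<delta> where 1: "0 \<le> B" "0 < \<delta>" "\<delta> \<le> 1"
    "\<And>i. i \<in> I \<Longrightarrow> norm (p i) \<le> B" "\<And>i. i \<in> I \<Longrightarrow> norm (q i) \<le> B" "\<And>i. i \<in> I \<Longrightarrow> norm (r i) \<le> B"
    "\<And>i s. i \<in> I \<Longrightarrow> \<bar>s\<bar> \<le> \<delta> \<Longrightarrow>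
      norm (g i s - p i - s *\<^sub>R q i - s\<^sup>2 *\<^sub>R r i) \<le> B * \<bar>s\<bar> ^ 3"
    using assms(1) by (rule expandsE) blast
  have "norm (c *\<^sub>R g i s - c *\<^sub>R p i - s *\<^sub>R (c *\<^sub>R q i) - s\<^sup>2 *\<^sub>R (c *\<^sub>R r i))
      \<le> (\<bar>c\<bar> * B) * \<bar>s\<bar> ^ 3" if "i \<in> I" "\<bar>s\<bar> \<le> \<delta>" for i s
  proof -
    have "c *\<^sub>R g i s - c *\<^sub>R p i - s *\<^sub>R (c *\<^sub>R q i) - s\<^sup>2 *\<^sub>R (c *\<^sub>R r i)
      = c *\<^sub>R (g i s - p i - s *\<^sub>R q i - s\<^sup>2 *\<^sub>R r i)"
      by (simp add: algebra_simps)
    then show ?thesis using mult_left_mono[OF 1(7)[OF that], of "\<bar>c\<bar>"] by (simp add: mult_ac)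
  qed
  then show ?thesis
    unfolding expands_def using 1
    by (intro exI[of _ "\<bar>c\<bar> * B"] exI[of _ "\<lambda>i. c *\<^sub>R r i"] exI[of _ \<delta>])
      (auto intro!: mult_left_mono)
qed

lemma expands_diff:
  assumes "expands I g p q" "expands I g' p' q'"
  shows "expands I (\<lambda>i s. g i s - g' i s) (\<lambda>i. p i - p' i) (\<lambda>i. q i - q' i)"
  using expands_add[OF assms(1) expands_scaleR[OF assms(2), of "-1"]] by simp

lemma expands_reparametrize:
  assumes "expands I g p q"
  shows "expands I (\<lambda>i s. g i (k * s)) p (\<lambda>i. k *\<^sub>R q i)"
proof -
  obtain B r \<delta> where 1: "0 \<le> B" "0 < \<delta>" "\<delta> \<le> 1"
    "\<And>i. i \<in> I \<Longrightarrow> norm (p i) \<le> B" "\<And>i. i \<in> I \<Longrightarrow> norm (q i) \<le> B" "\<And>i. i \<in> I \<Longrightarrow> norm (r i) \<le> B"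
    "\<And>i s. i \<in> I \<Longrightarrow> \<bar>s\<bar> \<le> \<delta> \<Longrightarrow>
      norm (g i s - p i - s *\<^sub>R q i - s\<^sup>2 *\<^sub>R r i) \<le> B * \<bar>s\<bar> ^ 3"
    using assms(1) by (rule expandsE) blast
  \<comment> \<open>Since \<open>c\<close> is at least 1, \<open>c ^ 3\<close> dominates every power
    of \<open>\<bar>k\<bar>\<close> up to the third. One constant thus serves all coefficients and
    the remainder, and \<open>\<delta> / c\<close> stays at most 1.\<close>
  define c where "c = max 1 \<bar>k\<bar>"
  have c: "1 \<le> c" "\<bar>k\<bar> \<le> c" "0 < c" by (auto simp: c_def)
  have c3: "\<bar>k\<bar> ^ j \<le> c ^ 3" if "j \<le> 3" for j
    using power_mono[OF c(2), of j] power_increasing[OF that c(1)] by simp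
  have bd: "\<bar>k\<bar> ^ j * b \<le> c ^ 3 * B" if "j \<le> 3" "0 \<le> b" "b \<le> B" for j b
    using c3[OF that(1)] that(2,3) c(3) by (intro mult_mono) auto
  have "norm (g i (k * s) - p i - s *\<^sub>R (k *\<^sub>R q i) - s\<^sup>2 *\<^sub>R (k\<^sup>2 *\<^sub>R r i))
      \<le> (c ^ 3 * B) * \<bar>s\<bar> ^ 3" if "i \<in> I" "\<bar>s\<bar> \<le> \<delta> / c" for i s
  proof -
    have "\<bar>k * s\<bar> \<le> c * \<bar>s\<bar>" using c by (simp add: abs_mult mult_right_mono)
    also have "\<dots> \<le> \<delta>" using that(2) c(3) by (simp add: field_simps)
    finally have "norm (g i (k * s) - p i - (k * s) *\<^sub>R q i - (k * s)\<^sup>2 *\<^sub>R r i) \<le> B * \<bar>k * s\<bar> ^ 3"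
      using 1(7) that(1) by blast
    also have "\<dots> = (\<bar>k\<bar> ^ 3 * B) * \<bar>s\<bar> ^ 3" by (simp add: abs_mult power_mult_distrib)
    also have "\<dots> \<le> (c ^ 3 * B) * \<bar>s\<bar> ^ 3"
      by (rule mult_right_mono[OF bd[OF order_refl 1(1) order_refl]]) simp
    finally show ?thesis by (simp add: power_mult_distrib mult.commute)
  qed
  moreover have "norm (p i) \<le> c ^ 3 * B \<and> norm (k *\<^sub>R q i) \<le> c ^ 3 * B \<and> norm (k\<^sup>2 *\<^sub>R r i) \<le> c ^ 3 * B"
    if "i \<in> I" for i
    using bd[of 0 "norm (p i)"] bd[of 1 "norm (q i)"] bd[of 2 "norm (r i)"] 1(4-6)[OF that] by simp
  moreover have "0 < \<delta> / c" "\<delta> / c \<le> 1" using 1(2,3) c by (auto simp: divide_simps)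
  moreover have "0 \<le> c ^ 3 * B" using c 1(1) by simp
  ultimately show ?thesis
    unfolding expands_def
    by (intro exI[of _ "c ^ 3 * B"] exI[of _ "\<lambda>i. k\<^sup>2 *\<^sub>R r i"] exI[of _ "\<delta> / c"]) blast
qed

lemma bilinear_square_perturbation:
  assumes "bilinear h"
  shows "h (s *\<^sub>R q + e) (s *\<^sub>R q + e)
    = s\<^sup>2 *\<^sub>R h q q + s *\<^sub>R h q e + s *\<^sub>R h e q + h e e"
  by (simp add: bilinear_ladd[OF assms] bilinear_radd[OF assms] bilinear_lmul[OF assms]
      bilinear_rmul[OF assms] power2_eq_square scaleR_add_right)

text \<open>A chain rule with uniform remainder. Taylor's formula for \<open>f\<close> is applied at
  \<open>p i\<close> to the whole increment \<open>d\<close>; multiplying out its linear and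
  quadratic terms leaves the coefficient \<open>R i\<close> at \<open>s^2\<close>, and every other
  new term carries at least three powers of \<open>s\<close>.\<close>

lemma expands_compose:
  fixes f :: "'a::euclidean_space \<Rightarrow> 'b::real_inner"
  assumes f: "smooth_on UNIV f" and g: "expands I g p q"
  shows "expands I (\<lambda>i s. f (g i s)) (\<lambda>i. f (p i)) (\<lambda>i. frechet_derivative f (at (p i)) (q i))"
proof -
  obtain B r \<delta> where 1: "0 \<le> B" "0 < \<delta>" "\<delta> \<le> 1"
    "\<And>i. i \<in> I \<Longrightarrow> norm (p i) \<le> B" "\<And>i. i \<in> I \<Longrightarrow> norm (q i) \<le> B" "\<And>i. i \<in> I \<Longrightarrow> norm (r i) \<le> B"
    "\<And>i s. i \<in> I \<Longrightarrow> \<bar>s\<bar> \<le> \<delta> \<Longrightarrow>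
      norm (g i s - p i - s *\<^sub>R q i - s\<^sup>2 *\<^sub>R r i) \<le> B * \<bar>s\<bar> ^ 3"
    using g by (rule expandsE) blast
  \<comment> \<open>For \<open>\<bar>s\<bar> \<le> \<delta> \<le> 1\<close> the increment has norm
    at most \<open>3 * B\<close>, so the segment from \<open>p i\<close> to \<open>g i s\<close>
    stays within radius \<open>4 * B\<close>.\<close>
  define C where "C = cball (0::'a) (4 * B)"
  have "\<exists>M. \<forall>n. 0 \<le> M n \<and> (\<forall>u\<in>C. \<forall>vs. length vs = n \<longrightarrow>
      norm (iter_deriv vs f u) \<le> M n * prod_list (map norm vs))"
    using iter_deriv_bounded_on_compact[OF f, of C] unfolding C_def
    by (intro choice) auto
  then obtain M where M0: "\<And>n. 0 \<le> M n"
    and M: "\<And>u vs. u \<in> C \<Longrightarrow> norm (iter_deriv vs f u) \<le> M (length vs) * prod_list (map norm vs)"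
    by blast
  let ?D = "\<lambda>i. frechet_derivative f (at (p i))"
  let ?D2 = "\<lambda>i v v'. iter_deriv [v, v'] f (p i)"
  define R where "R i = ?D i (r i) + (1/2) *\<^sub>R ?D2 i (q i) (q i)" for i
  \<comment> \<open>The first three summands dominate \<open>f (p i)\<close>,
    \<open>?D i (q i)\<close> and \<open>R i\<close>. The bracket bounds the remainder:
    \<open>M 1 * B\<close> comes from \<open>e\<close>, the 4 is half of 2 + 2 + 4 from the two
    mixed terms and the square of \<open>e'\<close>, and 27 is the cube of the 3 in
    \<open>norm d \<le> 3 * B * \<bar>s\<bar>\<close>.\<close>
  define L where "L = M 0 + M 1 * B + M 2 * B\<^sup>2 + (M 1 * B + 4 * M 2 * B\<^sup>2 + 27 * M 3 * B ^ 3)"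
  have nonneg: "0 \<le> M 0" "0 \<le> M 1 * B" "0 \<le> M 2 * B\<^sup>2" "0 \<le> M 3 * B ^ 3"
    using M0 1(1) by simp_all
  have lin: "linear (?D i)" for i using linear_frechet_derivative_smooth[OF f] by blast
  have bil: "bilinear (?D2 i)" for i using bilinear_second_derivative[OF f] .
  have D: "norm (?D i v) \<le> M 1 * b" if "i \<in> I" "norm v \<le> b" for i v b
  proof -
    have "norm (?D i v) \<le> M 1 * norm v"
      using M[of "p i" "[v]"] 1(1) 1(4)[OF that(1)] by (simp add: C_def)
    also have "\<dots> \<le> M 1 * b" using that M0 by (intro mult_left_mono)
    finally show ?thesis .
  qed
  have D2: "norm (?D2 i v v') \<le> M 2 * (b * b')"
    if "i \<in> I" "norm v \<le> b" "norm v' \<le> b'" for i v v' b b'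
  proof -
    have "norm (?D2 i v v') \<le> M 2 * (norm v * norm v')"
      using M[of "p i" "[v, v']"] 1(1) 1(4)[OF that(1)] by (simp add: C_def numeral_2_eq_2)
    also have "\<dots> \<le> M 2 * (b * b')"
      using that M0 order_trans[OF norm_ge_zero that(2)] by (intro mult_left_mono mult_mono) auto
    finally show ?thesis .
  qed
  have "norm (f (g i s) - f (p i) - s *\<^sub>R ?D i (q i) - s\<^sup>2 *\<^sub>R R i) \<le> L * \<bar>s\<bar> ^ 3"
    if i: "i \<in> I" and s: "\<bar>s\<bar> \<le> \<delta>" for i s
  proof -
    define d where "d = g i s - p i"
    define e where "e = g i s - p i - s *\<^sub>R q i - s\<^sup>2 *\<^sub>R r i"
    define e' where "e' = s\<^sup>2 *\<^sub>R r i + e"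
    have s1: "\<bar>s\<bar> \<le> 1" using s 1(3) by simp
    have s2: "s\<^sup>2 \<le> \<bar>s\<bar>" and s3: "\<bar>s\<bar> ^ 3 \<le> s\<^sup>2" and s4: "s\<^sup>2 * s\<^sup>2 \<le> \<bar>s\<bar> ^ 3"
      using power_decreasing[of 1 2 "\<bar>s\<bar>"] power_decreasing[of 2 3 "\<bar>s\<bar>"]
        power_decreasing[of 3 4 "\<bar>s\<bar>"] s1 by (auto simp flip: power_add)
    have e: "norm e \<le> B * \<bar>s\<bar> ^ 3" unfolding e_def using 1(7)[OF i s] .
    have "norm e' \<le> norm (s\<^sup>2 *\<^sub>R r i) + norm e" unfolding e'_def by (rule norm_triangle_ineq)
    also have "\<dots> \<le> s\<^sup>2 * B + B * s\<^sup>2"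
      using e 1(6)[OF i] mult_left_mono[OF s3 1(1)]
      by (intro add_mono) (auto intro!: mult_left_mono)
    finally have e': "norm e' \<le> 2 * B * s\<^sup>2" by simp
    have d_eq: "d = s *\<^sub>R q i + e'" by (simp add: d_def e_def e'_def)
    have "norm d \<le> norm (s *\<^sub>R q i) + norm e'" unfolding d_eq by (rule norm_triangle_ineq)
    also have "\<dots> \<le> \<bar>s\<bar> * B + 2 * B * \<bar>s\<bar>"
      using e' 1(5)[OF i] mult_left_mono[OF s2, of "2 * B"] 1(1)
      by (intro add_mono) (auto intro!: mult_left_mono)
    finally have d: "norm d \<le> 3 * B * \<bar>s\<bar>" by simp
    also have "\<dots> \<le> 3 * B" using s1 1(1) by (simp add: mult_left_le)
    finally have d1: "norm d \<le> 3 * B" .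
    \<comment> \<open>Taylor's formula is used with step 1 in the direction \<open>d\<close>; the
      factor \<open>\<bar>s\<bar> ^ 3\<close> comes from the cube of \<open>norm d\<close>.\<close>
    have "norm (iter_deriv [d, d, d] f (p i + \<theta> *\<^sub>R d)) \<le> 27 * M 3 * B ^ 3 * \<bar>s\<bar> ^ 3"
      if "\<bar>\<theta>\<bar> \<le> \<bar>1\<bar>" for \<theta>
    proof -
      have "norm (\<theta> *\<^sub>R d) \<le> norm d" using that by (simp add: mult_left_le_one_le)
      then have "norm (p i + \<theta> *\<^sub>R d) \<le> B + 3 * B"
        using 1(4)[OF i] d1 by (intro norm_triangle_mono) auto
      then have "norm (iter_deriv [d, d, d] f (p i + \<theta> *\<^sub>R d)) \<le> M 3 * norm d ^ 3"
        using M[of "p i + \<theta> *\<^sub>R d" "[d, d, d]"] by (simp add: C_def numeral_3_eq_3 mult.assoc)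
      also have "\<dots> \<le> M 3 * (3 * B * \<bar>s\<bar>) ^ 3"
        using d M0 by (intro mult_left_mono power_mono) auto
      finally show ?thesis by (simp add: power_mult_distrib mult_ac)
    qed
    then have T: "norm (f (p i + 1 *\<^sub>R d) - f (p i) - 1 *\<^sub>R iter_deriv [d] f (p i)
        - 1\<^sup>2 *\<^sub>R ((1/2) *\<^sub>R ?D2 i d d)) \<le> (27 * M 3 * B ^ 3 * \<bar>s\<bar> ^ 3) * \<bar>1\<bar> ^ 3"
      by (intro taylor_line[OF f]) auto
    have Dd: "?D i d = s *\<^sub>R ?D i (q i) + s\<^sup>2 *\<^sub>R ?D i (r i) + ?D i e"
      unfolding d_eq e'_def by (simp add: linear_add[OF lin] linear_cmul[OF lin])
    have D2d: "?D2 i d d = s\<^sup>2 *\<^sub>R ?D2 i (q i) (q i) + s *\<^sub>R ?D2 i (q i) e'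
        + s *\<^sub>R ?D2 i e' (q i) + ?D2 i e' e'"
      unfolding d_eq by (rule bilinear_square_perturbation[OF bil])
    have eq: "f (g i s) - f (p i) - s *\<^sub>R ?D i (q i) - s\<^sup>2 *\<^sub>R R i
      = (f (p i + d) - f (p i) - ?D i d - (1/2) *\<^sub>R ?D2 i d d) + ?D i e
        + (1/2) *\<^sub>R (s *\<^sub>R ?D2 i (q i) e' + s *\<^sub>R ?D2 i e' (q i) + ?D2 i e' e')"
      unfolding Dd D2d R_def by (simp del: iter_deriv.simps add: d_def algebra_simps)
    have "norm (f (g i s) - f (p i) - s *\<^sub>R ?D i (q i) - s\<^sup>2 *\<^sub>R R i) \<le> 27 * M 3 * B ^ 3 * \<bar>s\<bar> ^ 3 + M 1 * (B * \<bar>s\<bar> ^ 3)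
        + (1/2) * (2 * M 2 * B\<^sup>2 * \<bar>s\<bar> ^ 3 + 2 * M 2 * B\<^sup>2 * \<bar>s\<bar> ^ 3 + 4 * M 2 * B\<^sup>2 * \<bar>s\<bar> ^ 3)"
      unfolding eq
    proof (intro norm_triangle_mono)
      show "norm (f (p i + d) - f (p i) - ?D i d - (1/2) *\<^sub>R ?D2 i d d) \<le> 27 * M 3 * B ^ 3 * \<bar>s\<bar> ^ 3"
        using T by simp
      show "norm (?D i e) \<le> M 1 * (B * \<bar>s\<bar> ^ 3)" using D[OF i e] .
      have 3: "norm (s *\<^sub>R ?D2 i (q i) e') \<le> 2 * M 2 * B\<^sup>2 * \<bar>s\<bar> ^ 3"
        using mult_left_mono[OF D2[OF i 1(5)[OF i] e'], of "\<bar>s\<bar>"]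
        by (simp del: iter_deriv.simps add: power2_eq_square power3_eq_cube mult_ac)
      have 4: "norm (s *\<^sub>R ?D2 i e' (q i)) \<le> 2 * M 2 * B\<^sup>2 * \<bar>s\<bar> ^ 3"
        using mult_left_mono[OF D2[OF i e' 1(5)[OF i]], of "\<bar>s\<bar>"]
        by (simp del: iter_deriv.simps add: power2_eq_square power3_eq_cube mult_ac)
      have "norm (?D2 i e' e') \<le> (4 * M 2 * B\<^sup>2) * (s\<^sup>2 * s\<^sup>2)"
        using D2[OF i e' e'] by (simp del: iter_deriv.simps add: power2_eq_square mult_ac)
      also have "\<dots> \<le> (4 * M 2 * B\<^sup>2) * \<bar>s\<bar> ^ 3"
        using s4 nonneg by (intro mult_left_mono) auto
      finally have 5: "norm (?D2 i e' e') \<le> 4 * M 2 * B\<^sup>2 * \<bar>s\<bar> ^ 3" .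
      show "norm ((1/2) *\<^sub>R (s *\<^sub>R ?D2 i (q i) e' + s *\<^sub>R ?D2 i e' (q i) + ?D2 i e' e')) \<le>
        (1/2) * (2 * M 2 * B\<^sup>2 * \<bar>s\<bar> ^ 3 + 2 * M 2 * B\<^sup>2 * \<bar>s\<bar> ^ 3 + 4 * M 2 * B\<^sup>2 * \<bar>s\<bar> ^ 3)"
        unfolding norm_scaleR using 3 4 5
        by (intro mult_mono norm_triangle_mono) (auto simp del: iter_deriv.simps)
    qed
    also have "\<dots> = (M 1 * B + 4 * M 2 * B\<^sup>2 + 27 * M 3 * B ^ 3) * \<bar>s\<bar> ^ 3"
      by (simp add: algebra_simps)
    also have "\<dots> \<le> L * \<bar>s\<bar> ^ 3"
      unfolding L_def using nonneg by (intro mult_right_mono) (linarith, simp)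
    finally show ?thesis .
  qed
  moreover have "norm (f (p i)) \<le> L \<and> norm (?D i (q i)) \<le> L \<and> norm (R i) \<le> L" if i: "i \<in> I" for i
  proof -
    have "norm (f (p i)) \<le> M 0"
      using M[of "p i" "[]"] 1(1) 1(4)[OF i] by (simp add: C_def)
    moreover have "norm (?D i (q i)) \<le> M 1 * B" using D[OF i 1(5)[OF i]] .
    moreover have "norm (R i) \<le> M 1 * B + M 2 * B\<^sup>2"
      unfolding R_def
    proof (rule norm_triangle_mono)
      show "norm (?D i (r i)) \<le> M 1 * B" using D[OF i 1(6)[OF i]] .
      show "norm ((1/2) *\<^sub>R ?D2 i (q i) (q i)) \<le> M 2 * B\<^sup>2"
        using D2[OF i 1(5)[OF i] 1(5)[OF i]] nonneg
        by (simp del: iter_deriv.simps add: power2_eq_square)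
    qed
    ultimately show ?thesis unfolding L_def using nonneg by linarith
  qed
  moreover have "0 \<le> L" unfolding L_def using nonneg by linarith
  ultimately show ?thesis
    unfolding expands_def using 1(2,3)
    by (intro exI[of _ L] exI[of _ R] exI[of _ \<delta>]) blast
qed

lemma expands_central_difference:
  assumes "expands I g p q"
  obtains C \<delta> where "0 \<le> C" "0 < \<delta>"
    "\<And>i s. i \<in> I \<Longrightarrow> \<bar>s\<bar> \<le> \<delta> \<Longrightarrow> norm (g i s - g i (- s) - (2 * s) *\<^sub>R q i) \<le> C * \<bar>s\<bar> ^ 3"
proof -
  obtain B r \<delta> where 1: "0 \<le> B" "0 < \<delta>" "\<delta> \<le> 1"
    "\<And>i. i \<in> I \<Longrightarrow> norm (p i) \<le> B" "\<And>i. i \<in> I \<Longrightarrow> norm (q i) \<le> B" "\<And>i. i \<in> I \<Longrightarrow> norm (r i) \<le> B"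
    "\<And>i s. i \<in> I \<Longrightarrow> \<bar>s\<bar> \<le> \<delta> \<Longrightarrow>
      norm (g i s - p i - s *\<^sub>R q i - s\<^sup>2 *\<^sub>R r i) \<le> B * \<bar>s\<bar> ^ 3"
    using assms by (rule expandsE) blast
  show ?thesis
  proof (rule that[of "2 * B" \<delta>])
    fix i s assume i: "i \<in> I" and s: "\<bar>s\<bar> \<le> \<delta>"
    have "g i s - g i (- s) - (2 * s) *\<^sub>R q i = (g i s - p i - s *\<^sub>R q i - s\<^sup>2 *\<^sub>R r i)
      - (g i (- s) - p i - (- s) *\<^sub>R q i - (- s)\<^sup>2 *\<^sub>R r i)"
      by (simp add: algebra_simps scaleR_2[symmetric])
    also have "norm \<dots> \<le> B * \<bar>s\<bar> ^ 3 + B * \<bar>s\<bar> ^ 3"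
      by (rule order_trans[OF norm_triangle_ineq4 add_mono[OF 1(7)[OF i s]]])
        (use 1(7)[OF i, of "- s"] s in simp)
    finally show "norm (g i s - g i (- s) - (2 * s) *\<^sub>R q i) \<le> 2 * B * \<bar>s\<bar> ^ 3" by simp
  qed (use 1 in auto)
qed

subsection \<open>Expansion of the scheme\<close>

text \<open>Transport evaluates its argument at points \<open>x + k s\<close> moving with \<open>s\<close>. Here \<open>q\<close> is the derivative in
  \<open>s\<close> at a fixed point and \<open>d\<close> the derivative in space, so that the pair \<open>(q, d)\<close> can be propagated through
  each factor of the scheme.\<close>

definition ray_expands ::
  "'i set \<Rightarrow> ('i \<Rightarrow> real) \<Rightarrow> ('i \<Rightarrow> real \<Rightarrow> real \<Rightarrow> 'b::real_normed_vector) \<Rightarrow>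
   ('i \<Rightarrow> 'b) \<Rightarrow> ('i \<Rightarrow> 'b) \<Rightarrow> ('i \<Rightarrow> 'b) \<Rightarrow> bool" where
  "ray_expands I x F p q d \<longleftrightarrow>
     (\<forall>k. expands I (\<lambda>i s. F i s (x i + k * s)) p (\<lambda>i. q i + k *\<^sub>R d i))"

text \<open>Translation by plus or minus \<open>lam * s / c\<close> changes the slope
  \<open>k\<close> by \<open>lam / c\<close> downwards or upwards. Half sums cancel this change and
  half differences isolate \<open>- (lam / c)\<close> times the spatial derivative; the weights
  \<open>1 / lam\<close> and \<open>lam\<close> turn it into the right-hand side of the free
  transport system, scaled by \<open>1 / c\<close>.\<close>

lemma ray_expands_transport:
  fixes P :: "'i \<Rightarrow> real \<Rightarrow> 'm::finite fields"
  assumes lam: "lam \<noteq> 0"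
    and W: "ray_expands I x (\<lambda>i s. fst (P i s)) pw qw dw"
    and Z: "ray_expands I x (\<lambda>i s. snd (P i s)) pz qz dz"
  shows "ray_expands I x (\<lambda>i s. fst (transport lam (s / c) (P i s)))
      pw (\<lambda>i. qw i - (1 / c) *\<^sub>R dz i) dw"
    and "ray_expands I x (\<lambda>i s. snd (transport lam (s / c) (P i s)))
      pz (\<lambda>i. qz i - (lam\<^sup>2 / c) *\<^sub>R dw i) dz"
proof -
  have w: "expands I (\<lambda>i s. fst (P i s) (x i + k * s)) pw (\<lambda>i. qw i + k *\<^sub>R dw i)"
    and z: "expands I (\<lambda>i s. snd (P i s) (x i + k * s)) pz (\<lambda>i. qz i + k *\<^sub>R dz i)" for k
    using W Z unfolding ray_expands_def by auto
  have shift: "x i + k * s - lam * s / c = x i + (k - lam / c) * s"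
    "x i + k * s + lam * s / c = x i + (k + lam / c) * s" for i k s
    by (simp_all add: algebra_simps)
  show "ray_expands I x (\<lambda>i s. fst (transport lam (s / c) (P i s)))
      pw (\<lambda>i. qw i - (1 / c) *\<^sub>R dz i) dw"
    unfolding ray_expands_def
  proof
    fix k
    have "(\<lambda>i. (1/2) *\<^sub>R (pw i + pw i + (1 / lam) *\<^sub>R (pz i - pz i))) = pw"
      by (simp flip: scaleR_2)
    moreover have "(\<lambda>i. (1/2) *\<^sub>R ((qw i + (k - lam / c) *\<^sub>R dw i) + (qw i + (k + lam / c) *\<^sub>R dw i)
        + (1 / lam) *\<^sub>R ((qz i + (k - lam / c) *\<^sub>R dz i) - (qz i + (k + lam / c) *\<^sub>R dz i))))
      = (\<lambda>i. qw i - (1 / c) *\<^sub>R dz i + k *\<^sub>R dw i)"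
      using lam by (intro ext) (simp add: vec_eq_iff field_simps)
    moreover note expands_scaleR[OF expands_add[OF expands_add[OF w[of "k - lam / c"] w[of "k + lam / c"]]
        expands_scaleR[OF expands_diff[OF z[of "k - lam / c"] z[of "k + lam / c"]], of "1 / lam"]], of "1/2"]
    ultimately show "expands I (\<lambda>i s. fst (transport lam (s / c) (P i s)) (x i + k * s)) pw
      (\<lambda>i. qw i - (1 / c) *\<^sub>R dz i + k *\<^sub>R dw i)"
      by (simp add: transport_def translation_def case_prod_unfold shift)
  qed
  show "ray_expands I x (\<lambda>i s. snd (transport lam (s / c) (P i s)))
      pz (\<lambda>i. qz i - (lam\<^sup>2 / c) *\<^sub>R dw i) dz"
    unfolding ray_expands_def
  proof
    fix k
    have "(\<lambda>i. (1/2) *\<^sub>R (lam *\<^sub>R (pw i - pw i) + (pz i + pz i))) = pz"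
      by (simp flip: scaleR_2)
    moreover have "(\<lambda>i. (1/2) *\<^sub>R (lam *\<^sub>R ((qw i + (k - lam / c) *\<^sub>R dw i) - (qw i + (k + lam / c) *\<^sub>R dw i))
        + ((qz i + (k - lam / c) *\<^sub>R dz i) + (qz i + (k + lam / c) *\<^sub>R dz i))))
      = (\<lambda>i. qz i - (lam\<^sup>2 / c) *\<^sub>R dw i + k *\<^sub>R dz i)"
      by (intro ext) (simp add: vec_eq_iff field_simps power2_eq_square)
    moreover note expands_scaleR[OF expands_add[OF
        expands_scaleR[OF expands_diff[OF w[of "k - lam / c"] w[of "k + lam / c"]], of lam]
        expands_add[OF z[of "k - lam / c"] z[of "k + lam / c"]]], of "1/2"]
    ultimately show "expands I (\<lambda>i s. snd (transport lam (s / c) (P i s)) (x i + k * s)) pz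
      (\<lambda>i. qz i - (lam\<^sup>2 / c) *\<^sub>R dw i + k *\<^sub>R dz i)"
      by (simp add: transport_def translation_def case_prod_unfold shift)
  qed
qed

text \<open>\<open>R_0\<close> acts pointwise in \<open>x\<close>, so on each ray it is a
  composition with \<open>f\<close>; linearity of the derivative of \<open>f\<close> separates the
  part in \<open>q\<close> from the part in \<open>k d\<close> again.\<close>

lemma ray_expands_over_relaxation:
  fixes P :: "'i \<Rightarrow> real \<Rightarrow> 'm::finite fields"
  assumes f: "smooth_on UNIV f"
    and W: "ray_expands I x (\<lambda>i s. fst (P i s)) pw qw dw"
    and Z: "ray_expands I x (\<lambda>i s. snd (P i s)) pz qz dz"
  shows "ray_expands I x (\<lambda>i s. fst (over_relaxation f (P i s))) pw qw dw"
    and "ray_expands I x (\<lambda>i s. snd (over_relaxation f (P i s)))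
      (\<lambda>i. 2 *\<^sub>R f (pw i) - pz i)
      (\<lambda>i. 2 *\<^sub>R frechet_derivative f (at (pw i)) (qw i) - qz i)
      (\<lambda>i. 2 *\<^sub>R frechet_derivative f (at (pw i)) (dw i) - dz i)"
proof -
  show "ray_expands I x (\<lambda>i s. fst (over_relaxation f (P i s))) pw qw dw"
    using W by (simp add: over_relaxation_def case_prod_unfold)
  have w: "expands I (\<lambda>i s. fst (P i s) (x i + k * s)) pw (\<lambda>i. qw i + k *\<^sub>R dw i)"
    and z: "expands I (\<lambda>i s. snd (P i s) (x i + k * s)) pz (\<lambda>i. qz i + k *\<^sub>R dz i)" for k
    using W Z unfolding ray_expands_def by auto
  have lin: "linear (frechet_derivative f (at (pw i)))" for i
    using linear_frechet_derivative_smooth[OF f] by blast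
  show "ray_expands I x (\<lambda>i s. snd (over_relaxation f (P i s)))
      (\<lambda>i. 2 *\<^sub>R f (pw i) - pz i)
      (\<lambda>i. 2 *\<^sub>R frechet_derivative f (at (pw i)) (qw i) - qz i)
      (\<lambda>i. 2 *\<^sub>R frechet_derivative f (at (pw i)) (dw i) - dz i)"
    unfolding ray_expands_def
  proof
    fix k
    have "(\<lambda>i. 2 *\<^sub>R frechet_derivative f (at (pw i)) (qw i + k *\<^sub>R dw i) - (qz i + k *\<^sub>R dz i))
      = (\<lambda>i. 2 *\<^sub>R frechet_derivative f (at (pw i)) (qw i) - qz i
          + k *\<^sub>R (2 *\<^sub>R frechet_derivative f (at (pw i)) (dw i) - dz i))"
      by (intro ext) (simp add: linear_add[OF lin] linear_cmul[OF lin] algebra_simps)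
    with expands_diff[OF expands_scaleR[OF expands_compose[OF f w], of 2] z, of k k]
    show "expands I (\<lambda>i s. snd (over_relaxation f (P i s)) (x i + k * s))
      (\<lambda>i. 2 *\<^sub>R f (pw i) - pz i)
      (\<lambda>i. 2 *\<^sub>R frechet_derivative f (at (pw i)) (qw i) - qz i
          + k *\<^sub>R (2 *\<^sub>R frechet_derivative f (at (pw i)) (dw i) - dz i))"
      by (simp add: over_relaxation_def case_prod_unfold)
  qed
qed

text \<open>In the first component the transports see the spatial derivatives of \<open>z\<close>,
  \<open>2 f(w) - z\<close> and \<open>z\<close>, with weights 1/4, 1/2, 1/4, so those of
  \<open>z\<close> cancel. In the second, each later \<open>R_0\<close> reverses the sign of a
  transport contribution: the terms in \<open>lam^2\<close> carry -1/4, +1/2, -1/4 and vanish, and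
  what remains is twice the derivative of \<open>f\<close> applied to the increment of
  \<open>w\<close> between the two relaxations.\<close>

lemma expands_scheme2:
  fixes a b :: "'i \<Rightarrow> real \<Rightarrow> real^'m"
  assumes lam: "lam \<noteq> 0" and f: "smooth_on UNIV f"
    and a: "expands I (\<lambda>i s. a i (x i + s)) pa da"
    and b: "expands I (\<lambda>i s. b i (x i + s)) pb db"
  shows "expands I (\<lambda>i s. fst (scheme2 lam f s (a i, b i)) (x i))
      pa (\<lambda>i. - frechet_derivative f (at (pa i)) (da i))"
    and "expands I (\<lambda>i s. snd (scheme2 lam f s (a i, b i)) (x i))
      pb (\<lambda>i. frechet_derivative f (at (pa i))
        (db i - 2 *\<^sub>R frechet_derivative f (at (pa i)) (da i)))"
proof -
  have lin: "linear (frechet_derivative f (at (pa i)))" for i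
    using linear_frechet_derivative_smooth[OF f] by blast
  \<comment> \<open>The initial fields do not depend on \<open>s\<close>, so \<open>q\<close> is 0,
    and slope 1 yields every slope \<open>k\<close> by rescaling \<open>s\<close>.\<close>
  have "ray_expands I x (\<lambda>i s. fst (a i, b i)) pa (\<lambda>i. 0) da"
    "ray_expands I x (\<lambda>i s. snd (a i, b i)) pb (\<lambda>i. 0) db"
    using expands_reparametrize[OF a] expands_reparametrize[OF b]
    unfolding ray_expands_def by auto
  note 1 = ray_expands_transport[OF lam this, of 4]
  note 2 = ray_expands_over_relaxation[OF f 1]
  note 3 = ray_expands_transport[OF lam 2, of 2]
  note 4 = ray_expands_over_relaxation[OF f 3]
  note 5 = ray_expands_transport[OF lam 4, of 4]
  \<comment> \<open>Slope 0 returns from moving points to the fixed point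
    \<open>x i\<close>.\<close>
  note 6 = 5[unfolded ray_expands_def, rule_format, of 0]
  have "(\<lambda>i. 2 *\<^sub>R f (pa i) - (2 *\<^sub>R f (pa i) - pb i)) = pb" by simp
  moreover have "(\<lambda>i. 0 - (1 / 4) *\<^sub>R db i -
          (1 / 2) *\<^sub>R (2 *\<^sub>R frechet_derivative f (at (pa i)) (da i) - db i) -
          (1 / 4) *\<^sub>R (2 *\<^sub>R frechet_derivative f (at (pa i)) (da i) -
             (2 *\<^sub>R frechet_derivative f (at (pa i)) (da i) - db i)) + 0 *\<^sub>R da i)
     = (\<lambda>i. - frechet_derivative f (at (pa i)) (da i))"
    by (intro ext) (simp add: vec_eq_iff field_simps)
  moreover have "(\<lambda>i. 2 *\<^sub>R frechet_derivative f (at (pa i))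
           (0 - (1 / 4) *\<^sub>R db i - (1 / 2) *\<^sub>R (2 *\<^sub>R frechet_derivative f (at (pa i)) (da i) - db i)) -
          (2 *\<^sub>R frechet_derivative f (at (pa i)) (0 - (1 / 4) *\<^sub>R db i) -
            (0 - (lam\<^sup>2 / 4) *\<^sub>R da i) - (lam\<^sup>2 / 2) *\<^sub>R da i) -
          (lam\<^sup>2 / 4) *\<^sub>R da i +
          0 *\<^sub>R (2 *\<^sub>R frechet_derivative f (at (pa i)) (da i) -
            (2 *\<^sub>R frechet_derivative f (at (pa i)) (da i) - db i)))
     = (\<lambda>i. frechet_derivative f (at (pa i))
        (db i - 2 *\<^sub>R frechet_derivative f (at (pa i)) (da i)))"
    by (intro ext) (simp add: linear_diff[OF lin] linear_cmul[OF lin] linear_0[OF lin] linear_add[OF lin] linear_neg[OF lin] vec_eq_iff field_simps)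
  ultimately show "expands I (\<lambda>i s. fst (scheme2 lam f s (a i, b i)) (x i))
      pa (\<lambda>i. - frechet_derivative f (at (pa i)) (da i))"
    and "expands I (\<lambda>i s. snd (scheme2 lam f s (a i, b i)) (x i))
      pb (\<lambda>i. frechet_derivative f (at (pa i))
        (db i - 2 *\<^sub>R frechet_derivative f (at (pa i)) (da i)))"
    using 6 unfolding scheme2_def comp_def mult_zero_left add_0_right by simp_all
qed

subsection \<open>Block systems\<close>

lemma sum_UNIV_sum: "sum g (UNIV :: ('a::finite + 'b::finite) set) = (\<Sum>x\<in>UNIV. g (Inl x)) + (\<Sum>x\<in>UNIV. g (Inr x))"
  using sum.Plus[of UNIV UNIV g] by (simp add: comp_def)

lemma block_diag_mult: "block_diag A B ** block_diag C E = block_diag (A ** C) (B ** E)"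
  unfolding vec_eq_iff
  by (intro allI) (simp add: matrix_matrix_mult_def block_diag_def sum_UNIV_sum split: sum.split)

lemma block_diag_mat_1: "block_diag (mat 1) (mat 1) = mat 1"
  by (simp add: vec_eq_iff block_diag_def mat_def split: sum.split)

lemma block_diag_vector_mult: "block_diag A B *v stack a b = stack (A *v a) (B *v b)"
  by (simp add: vec_eq_iff matrix_vector_mult_def block_diag_def stack_def sum_UNIV_sum split: sum.split)

lemma stack_add: "stack a b + stack c d = stack (a + c) (b + d)"
  by (simp add: vec_eq_iff stack_def split: sum.split)

lemma upper_stack [simp]: "upper (stack a b) = a"
  by (simp add: vec_eq_iff upper_def stack_def)

lemma norm_stack_le: "norm (stack a b) \<le> norm a + norm b"
proof -
  have "norm (stack a b) = sqrt ((norm a)\<^sup>2 + (norm b)\<^sup>2)"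
    by (simp add: norm_vec_def L2_set_def sum_UNIV_sum stack_def sum_nonneg)
  then show ?thesis by (simp add: sqrt_sum_squares_le_sum)
qed

lemma bounded_linear_stack: "bounded_linear (\<lambda>p. stack (fst p) (snd p))"
  by (rule linear_conv_bounded_linear[THEN iffD1], rule linearI)
    (simp_all add: vec_eq_iff stack_def split: sum.split)

text \<open>The basis \<open>P\<close> that diagonalizes \<open>A\<close> also diagonalizes
  \<open>- A\<close>, so two copies of \<open>P\<close> suffice. As \<open>matrix_inv\<close> is a
  chosen inverse, it must be identified with the block matrix of inverses.\<close>

lemma real_diagonalizable_block_diag:
  fixes A :: "real^'n^'n"
  assumes "real_diagonalizable A"
  shows "real_diagonalizable (block_diag A (- A))"
proof -
  obtain P D :: "real^'n^'n" where P: "invertible P" and D: "\<And>i j. i \<noteq> j \<Longrightarrow> D $ i $ j = 0"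
    and A: "A = P ** D ** matrix_inv P"
    using assms unfolding real_diagonalizable_def by blast
  have inv: "P ** matrix_inv P = mat 1 \<and> matrix_inv P ** P = mat 1"
    using P unfolding invertible_def matrix_inv_def by (rule someI_ex)
  let ?P = "block_diag P P" and ?P' = "block_diag (matrix_inv P) (matrix_inv P)"
  have PP: "?P ** ?P' = mat 1" "?P' ** ?P = mat 1"
    using inv by (simp_all add: block_diag_mult block_diag_mat_1)
  then have iP: "invertible ?P" unfolding invertible_def by blast
  then have "?P ** matrix_inv ?P = mat 1 \<and> matrix_inv ?P ** ?P = mat 1"
    unfolding invertible_def matrix_inv_def by (rule someI_ex)
  \<comment> \<open>Uniqueness of the inverse: a right inverse multiplied from the left by the left
    inverse \<open>?P'\<close>.\<close>
  then have "?P' ** (?P ** matrix_inv ?P) = ?P'" by simp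
  then have eq: "matrix_inv ?P = ?P'" by (simp add: matrix_mul_assoc PP(2))
  have "- A = P ** (- D) ** matrix_inv P"
    unfolding A by (simp add: vec_eq_iff matrix_matrix_mult_def sum_negf)
  then have "block_diag A (- A) = ?P ** block_diag D (- D) ** matrix_inv ?P"
    unfolding eq block_diag_mult using A by simp
  moreover have "block_diag D (- D) $ i $ j = 0" if "i \<noteq> j" for i j
    using that D by (auto simp: block_diag_def split: sum.split)
  ultimately show ?thesis unfolding real_diagonalizable_def using iP by blast
qed

lemma hyperbolic_flux_error_matrix:
  assumes "hyperbolic (\<lambda>u. jacobian f (at u))"
  shows "hyperbolic (flux_error_matrix f)"
  using assms unfolding hyperbolic_def flux_error_matrix_def
  by (auto intro: real_diagonalizable_block_diag)

section \<open>The residual in terms of first partial derivatives\<close>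

lemma jacobian_smooth_works:
  fixes f :: "real^'n \<Rightarrow> real^'m"
  assumes "smooth_on UNIV f"
  shows "jacobian f (at u) *v v = frechet_derivative f (at u) v"
proof -
  have "f differentiable (at u)"
    using frechet_derivative_smooth[OF assms UNIV_I] by (rule differentiableI)
  then have "(f has_derivative (\<lambda>v. jacobian f (at u) *v v)) (at u)" by (rule jacobian_works[THEN iffD1])
  from frechet_derivative_at[OF this] show ?thesis by (rule fun_cong)
qed

lemma vector_derivative_slices:
  fixes u :: "real \<times> real \<Rightarrow> 'b::real_normed_vector"
  assumes "(u has_derivative u') (at (x, t))"
  shows "((\<lambda>s. u (x, s)) has_vector_derivative u' (0, 1)) (at t)"
    and "((\<lambda>\<xi>. u (\<xi>, t)) has_vector_derivative u' (1, 0)) (at x)"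
proof -
  have lin: "linear u'" using assms by (rule has_derivative_linear)
  have line: "((\<lambda>s. (x, s)) has_derivative (\<lambda>r. (0, r))) (at t)"
    "((\<lambda>\<xi>. (\<xi>, t)) has_derivative (\<lambda>r. (r, 0))) (at x)"
    by (auto intro!: has_derivative_Pair)
  have "u' (0, r) = r *\<^sub>R u' (0, 1)" "u' (r, 0) = r *\<^sub>R u' (1, 0)" for r
    using linear_cmul[OF lin, of r "(0, 1)"] linear_cmul[OF lin, of r "(1, 0)"] by simp_all
  note eq = this[THEN ext]
  show "((\<lambda>s. u (x, s)) has_vector_derivative u' (0, 1)) (at t)"
    unfolding has_vector_derivative_def eq(1)[symmetric]
    by (rule has_derivative_compose[OF line(1) assms])
  show "((\<lambda>\<xi>. u (\<xi>, t)) has_vector_derivative u' (1, 0)) (at x)"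
    unfolding has_vector_derivative_def eq(2)[symmetric]
    by (rule has_derivative_compose[OF line(2) assms])
qed

text \<open>Brings the residual into the form that the central differences can control: apart from
  the linear map \<open>A\<close>, only the four partial derivatives of \<open>w\<close> and
  \<open>z\<close> at \<open>p\<close> remain.\<close>

lemma system_residual_flux_error:
  fixes f :: "real^'m \<Rightarrow> real^'m" and w z :: "real \<times> real \<Rightarrow> real^'m" and p :: "real \<times> real"
  assumes f: "smooth_on UNIV f" and w: "smooth_on D w" and z: "smooth_on D z" and p: "p \<in> D"
  defines "A \<equiv> frechet_derivative f (at (w p))"
    and "Dw \<equiv> frechet_derivative w (at p)" and "Dz \<equiv> frechet_derivative z (at p)"
  shows "system_residual (flux_error_matrix f) (\<lambda>p. stack (w p) (flux_error f w z p)) p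
    = stack (Dw (0, 1) + A (Dw (1, 0)))
        ((Dz (0, 1) - A (Dw (0, 1))) - A (Dz (1, 0) - A (Dw (1, 0))))"
proof -
  obtain x t where xt: "p = (x, t)" by (cases p)
  have "((\<lambda>p. f (w p)) has_derivative (\<lambda>v. A (Dw v))) (at p)"
    unfolding A_def Dw_def
    by (rule has_derivative_compose[OF frechet_derivative_smooth[OF w p]
          frechet_derivative_smooth[OF f UNIV_I]])
  then have y: "(flux_error f w z has_derivative (\<lambda>v. Dz v - A (Dw v))) (at (x, t))"
    unfolding flux_error_def[abs_def] xt[symmetric] Dz_def
    by (rule has_derivative_diff[OF frechet_derivative_smooth[OF z p]])
  have w': "(w has_derivative Dw) (at (x, t))"
    unfolding xt[symmetric] Dw_def using w p by (rule frechet_derivative_smooth)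
  \<comment> \<open>Stacking is a bounded linear map on pairs, so it commutes with differentiation
    of the two blocks.\<close>
  note st = bounded_linear.has_vector_derivative[OF bounded_linear_stack has_vector_derivative_Pair,
      unfolded fst_conv snd_conv]
  have "vector_derivative (\<lambda>s. stack (w (x, s)) (flux_error f w z (x, s))) (at t)
      = stack (Dw (0, 1)) (Dz (0, 1) - A (Dw (0, 1)))"
    by (intro vector_derivative_at st vector_derivative_slices[OF w'] vector_derivative_slices[OF y])
  moreover have "vector_derivative (\<lambda>\<xi>. stack (w (\<xi>, t)) (flux_error f w z (\<xi>, t))) (at x)
      = stack (Dw (1, 0)) (Dz (1, 0) - A (Dw (1, 0)))"
    by (intro vector_derivative_at st vector_derivative_slices[OF w'] vector_derivative_slices[OF y])
  moreover have "- jacobian f (at (w p)) *v v = - A v" for v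
    unfolding A_def jacobian_smooth_works[OF f, symmetric]
    by (simp add: vec_eq_iff matrix_vector_mult_def sum_negf)
  ultimately show ?thesis
    by (simp add: xt system_residual_def flux_error_matrix_def block_diag_vector_mult stack_add
        jacobian_smooth_works[OF f] A_def[unfolded xt, symmetric])
qed

subsection \<open>The equivalent equation\<close>

lemma expands_subset: "expands I g p q \<Longrightarrow> I' \<subseteq> I \<Longrightarrow> expands I' g p q"
  unfolding expands_def by (meson subsetD)

text \<open>The bounds hold on compact subsets of \<open>D\<close>, but the segments starting in
  \<open>K\<close> leave \<open>K\<close>. They stay in a compact neighbourhood \<open>K'\<close> of
  \<open>K\<close> inside \<open>D\<close>, on which the bounds are uniform in \<open>h\<close>;
  this makes \<open>taylor_line\<close> uniform in the index.\<close>

lemma expands_smooth_family: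
  fixes u :: "real \<Rightarrow> 'a::euclidean_space \<Rightarrow> 'b::real_inner"
  assumes D: "open D" and K: "compact K" "K \<subseteq> D"
    and smooth: "\<forall>\<^sub>F h in at_right 0. smooth_on D (u h)"
    and bounds: "\<And>vs. length vs \<le> 3 \<Longrightarrow>
      locally_uniform_bigo D (\<lambda>h. iter_deriv vs (u h)) (\<lambda>h. 1)"
  shows "\<exists>h0>0. expands ({0<..<h0} \<times> K) (\<lambda>i s. u (fst i) (snd i + s *\<^sub>R v))
    (\<lambda>i. u (fst i) (snd i)) (\<lambda>i. frechet_derivative (u (fst i)) (at (snd i)) v)"
proof -
  obtain \<epsilon> where \<epsilon>: "\<epsilon> > 0" "(\<Union>x\<in>K. cball x \<epsilon>) \<subseteq> D"
    using compact_subset_open_imp_cball_epsilon_subset[OF K(1) D K(2)] by blast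
  \<comment> \<open>Written as the sum of \<open>K\<close> and a closed ball, which makes
    compactness immediate.\<close>
  define K' where "K' = (\<Union>x\<in>K. \<Union>y\<in>cball 0 \<epsilon>. {x + y})"
  have K': "compact K'" unfolding K'_def using K(1) compact_cball by (rule compact_sums')
  have mem: "p + y \<in> K'" if "p \<in> K" "norm y \<le> \<epsilon>" for p y
    unfolding K'_def UN_iff singleton_iff using that
    by (intro bexI[of _ p] bexI[of _ y]) (auto simp: dist_norm)
  have "K' \<subseteq> D"
  proof
    fix q assume "q \<in> K'"
    then obtain x y where "x \<in> K" "norm y \<le> \<epsilon>" "q = x + y" unfolding K'_def by auto
    then have "q \<in> cball x \<epsilon>" by (simp add: dist_norm)
    with \<open>x \<in> K\<close> \<epsilon>(2) show "q \<in> D" by blast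
  qed
  \<comment> \<open>Only the orders 0 to 3 in the single direction \<open>v\<close> matter, so
    finitely many eventual bounds are merged into one threshold \<open>h0\<close>.\<close>
  have "\<forall>m\<in>{..3}. \<exists>C. \<forall>\<^sub>F h in at_right 0. \<forall>p\<in>K'. norm (iter_deriv (replicate m v) (u h) p) \<le> C"
    using bounds[unfolded locally_uniform_bigo_def, rule_format, of "replicate m v" K' for m]
      K' \<open>K' \<subseteq> D\<close> by simp
  from bchoice[OF this] obtain C where "\<forall>m\<in>{..3}. \<forall>\<^sub>F h in at_right 0.
      \<forall>p\<in>K'. norm (iter_deriv (replicate m v) (u h) p) \<le> C m" by blast
  then have "\<forall>\<^sub>F h in at_right 0. \<forall>m\<in>{..3}. \<forall>p\<in>K'. norm (iter_deriv (replicate m v) (u h) p) \<le> C m"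
    by (intro eventually_ball_finite) auto
  with smooth have "\<forall>\<^sub>F h in at_right 0. smooth_on D (u h) \<and>
      (\<forall>m\<in>{..3}. \<forall>p\<in>K'. norm (iter_deriv (replicate m v) (u h) p) \<le> C m)"
    by (rule eventually_conj)
  then obtain h0 where "h0 > 0" and h0: "\<And>h. 0 < h \<Longrightarrow> h < h0 \<Longrightarrow> smooth_on D (u h)"
    "\<And>h m p. 0 < h \<Longrightarrow> h < h0 \<Longrightarrow> m \<le> 3 \<Longrightarrow> p \<in> K' \<Longrightarrow> norm (iter_deriv (replicate m v) (u h) p) \<le> C m"
    unfolding eventually_at_right_field by auto
  define B where "B = \<bar>C 0\<bar> + \<bar>C 1\<bar> + \<bar>C 2\<bar> + \<bar>C 3\<bar>"
  \<comment> \<open>The summand 1 in the denominator admits \<open>v = 0\<close> and still keeps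
    \<open>\<theta> *\<^sub>R v\<close> within \<open>\<epsilon>\<close>.\<close>
  define \<delta> where "\<delta> = min 1 (\<epsilon> / (1 + norm v))"
  have CB: "C m \<le> B" if "m \<le> 3" for m
  proof -
    have "m = 0 \<or> m = 1 \<or> m = 2 \<or> m = 3" using that by linarith
    then show ?thesis unfolding B_def by auto
  qed
  have bound: "norm (iter_deriv (replicate m v) (u h) p) \<le> B"
    if "0 < h" "h < h0" "m \<le> 3" "p \<in> K'" for h m p
    using h0(2)[OF that] CB[OF that(3)] by linarith
  have \<delta>: "0 < \<delta>" "\<delta> \<le> 1" using \<epsilon>(1) by (auto simp: \<delta>_def intro!: divide_pos_pos add_pos_nonneg)
  have line: "p + \<theta> *\<^sub>R v \<in> K'" if "p \<in> K" "\<bar>\<theta>\<bar> \<le> \<delta>" for p \<theta>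
  proof (rule mem[OF that(1)])
    have "norm (\<theta> *\<^sub>R v) \<le> \<epsilon> / (1 + norm v) * (1 + norm v)"
      unfolding norm_scaleR using that(2) \<epsilon>(1) by (intro mult_mono) (auto simp: \<delta>_def)
    also have "\<dots> = \<epsilon>" by (simp add: add_nonneg_eq_0_iff)
    finally show "norm (\<theta> *\<^sub>R v) \<le> \<epsilon>" .
  qed
  have "norm (u h (p + s *\<^sub>R v) - u h p - s *\<^sub>R frechet_derivative (u h) (at p) v
      - s\<^sup>2 *\<^sub>R ((1/2) *\<^sub>R iter_deriv [v, v] (u h) p)) \<le> B * \<bar>s\<bar> ^ 3"
    if "0 < h" "h < h0" "p \<in> K" "\<bar>s\<bar> \<le> \<delta>" for h p s
    using taylor_line[OF h0(1)[OF that(1,2)], of s p v B] bound[OF that(1,2), of 3]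
      line[OF that(3)] that(4) \<open>K' \<subseteq> D\<close>
    by (force simp: numeral_3_eq_3)
  moreover have "norm (u h p) \<le> B" "norm (frechet_derivative (u h) (at p) v) \<le> B"
    "norm ((1/2) *\<^sub>R iter_deriv [v, v] (u h) p) \<le> B" if "0 < h" "h < h0" "p \<in> K" for h p
  proof -
    have p: "p \<in> K'" using line[OF that(3), of 0] \<delta> by simp
    show "norm (u h p) \<le> B" using bound[OF that(1,2) _ p, of 0] by simp
    show "norm (frechet_derivative (u h) (at p) v) \<le> B" using bound[OF that(1,2) _ p, of 1] by simp
    have "norm (iter_deriv [v, v] (u h) p) \<le> B"
      using bound[OF that(1,2) _ p, of 2] by (simp add: numeral_2_eq_2)
    then show "norm ((1/2) *\<^sub>R iter_deriv [v, v] (u h) p) \<le> B"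
      unfolding norm_scaleR using norm_ge_zero[of "iter_deriv [v, v] (u h) p"] by linarith
  qed
  moreover have "0 \<le> B" by (simp add: B_def)
  ultimately have "expands ({0<..<h0} \<times> K) (\<lambda>i s. u (fst i) (snd i + s *\<^sub>R v))
    (\<lambda>i. u (fst i) (snd i)) (\<lambda>i. frechet_derivative (u (fst i)) (at (snd i)) v)"
    unfolding expands_def using \<delta>
    by (intro exI[of _ B] exI[of _ "\<lambda>i. (1/2) *\<^sub>R iter_deriv [v, v] (u (fst i)) (snd i)"] exI[of _ \<delta>]) auto
  with \<open>h0 > 0\<close> show ?thesis by blast
qed

text \<open>The first component \<open>h\<close> of the index doubles as the time step, and both
  expansions are evaluated at \<open>s = h / 2\<close>. Uniformity in the index is what permits this
  dependence. The difference of the two remainders is \<open>h\<close> times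
  \<open>q i - q' i\<close> and of order \<open>h^3\<close>; cancelling \<open>h\<close> leaves
  \<open>h^2\<close>.\<close>

lemma expands_equal_central_differences:
  fixes I :: "(real \<times> 'a) set"
  assumes g: "expands I g p q" and g': "expands I g' p' q'"
    and eq: "\<And>i. i \<in> I \<Longrightarrow> 0 < fst i \<Longrightarrow>
      g i (fst i / 2) - g i (- (fst i / 2)) = g' i (fst i / 2) - g' i (- (fst i / 2))"
  obtains C h0 where "0 \<le> C" "0 < h0"
    "\<And>i. i \<in> I \<Longrightarrow> 0 < fst i \<Longrightarrow> fst i < h0 \<Longrightarrow> norm (q i - q' i) \<le> C * (fst i)\<^sup>2"
proof -
  obtain C \<delta> where 1: "0 \<le> C" "0 < \<delta>" "\<And>i s. i \<in> I \<Longrightarrow> \<bar>s\<bar> \<le> \<delta> \<Longrightarrow>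
      norm (g i s - g i (- s) - (2 * s) *\<^sub>R q i) \<le> C * \<bar>s\<bar> ^ 3"
    using expands_central_difference[OF g] by blast
  obtain C' \<delta>' where 2: "0 \<le> C'" "0 < \<delta>'" "\<And>i s. i \<in> I \<Longrightarrow> \<bar>s\<bar> \<le> \<delta>' \<Longrightarrow>
      norm (g' i s - g' i (- s) - (2 * s) *\<^sub>R q' i) \<le> C' * \<bar>s\<bar> ^ 3"
    using expands_central_difference[OF g'] by blast
  show ?thesis
  proof (rule that[of "C + C'" "min \<delta> \<delta>'"])
    fix i assume i: "i \<in> I" "0 < fst i" "fst i < min \<delta> \<delta>'"
    define h where "h = fst i"
    have h: "0 < h" "\<bar>h / 2\<bar> \<le> \<delta>" "\<bar>h / 2\<bar> \<le> \<delta>'" using i by (auto simp: h_def)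
    have "h *\<^sub>R (q i - q' i) = (g' i (h/2) - g' i (- (h/2)) - (2 * (h/2)) *\<^sub>R q' i)
        - (g i (h/2) - g i (- (h/2)) - (2 * (h/2)) *\<^sub>R q i)"
      using eq[OF i(1,2)] by (simp add: h_def algebra_simps)
    also have "norm \<dots> \<le> C' * \<bar>h/2\<bar> ^ 3 + C * \<bar>h/2\<bar> ^ 3"
      by (rule order_trans[OF norm_triangle_ineq4 add_mono[OF 2(3)[OF i(1) h(3)] 1(3)[OF i(1) h(2)]]])
    also have "\<dots> = (C + C') * \<bar>h/2\<bar> ^ 3" by (simp add: algebra_simps)
    also have "\<dots> \<le> (C + C') * h ^ 3"
      using 1(1) 2(1) h(1) by (intro mult_left_mono power_mono) auto
    finally have "h * norm (q i - q' i) \<le> h * ((C + C') * h\<^sup>2)"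
      using h(1) by (simp add: power2_eq_square power3_eq_cube mult_ac)
    then show "norm (q i - q' i) \<le> (C + C') * (fst i)\<^sup>2"
      using h(1) by (simp add: h_def)
  qed (use 1 2 in auto)
qed

theorem theorem1:
  fixes f :: "real^'m \<Rightarrow> real^'m"
    and lam :: real
    and J :: "real set"
    and w z :: "real \<Rightarrow> real \<times> real \<Rightarrow> real^'m"
  assumes f_smooth: "smooth_on UNIV f"
    and f_hyperbolic: "hyperbolic (\<lambda>u. jacobian f (at u))"
    and lam_pos: "lam > 0"
    and J_open: "open J"
    and wz_smooth: "\<forall>\<^sub>F h in at_right 0. smooth_on (UNIV \<times> J) (w h) \<and> smooth_on (UNIV \<times> J) (z h)"
    and w_bounds: "\<And>vs. length vs \<le> 3 \<Longrightarrow>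
          locally_uniform_bigo (UNIV \<times> J) (\<lambda>h. iter_deriv vs (w h)) (\<lambda>h. 1)"
    and z_bounds: "\<And>vs. length vs \<le> 3 \<Longrightarrow>
          locally_uniform_bigo (UNIV \<times> J) (\<lambda>h. iter_deriv vs (z h)) (\<lambda>h. 1)"
    and algorithm: "\<forall>\<^sub>F h in at_right 0. solves_time_marching lam f J h (w h) (z h)"
  shows "hyperbolic (flux_error_matrix f)
       \<and> locally_uniform_bigo (UNIV \<times> J)
           (\<lambda>h. system_residual (flux_error_matrix f) (\<lambda>p. stack (w h p) (flux_error f (w h) (z h) p)))
           (\<lambda>h. h\<^sup>2)"
proof
  show "hyperbolic (flux_error_matrix f)" using f_hyperbolic by (rule hyperbolic_flux_error_matrix)
  define residual where "residual h = system_residual (flux_error_matrix f)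
    (\<lambda>p. stack (w h p) (flux_error f (w h) (z h) p))" for h
  have lam: "lam \<noteq> 0" using lam_pos by simp
  have lin: "linear (frechet_derivative f (at u))" for u
    using linear_frechet_derivative_smooth[OF f_smooth] by blast
  have D: "open (UNIV \<times> J :: (real \<times> real) set)" using J_open by (intro open_Times) auto
  have "\<exists>C. \<forall>\<^sub>F h in at_right 0. \<forall>p\<in>K. norm (residual h p) \<le> C * \<bar>h\<^sup>2\<bar>"
    if K: "compact K" "K \<subseteq> UNIV \<times> J" for K
  proof -
    \<comment> \<open>The marching equation is available only where \<open>t\<close> and
      \<open>t\<close> plus or minus \<open>h / 2\<close> lie in \<open>J\<close>; for
      \<open>h\<close> below \<open>\<epsilon>\<close> this holds at every point of
      \<open>K\<close>.\<close>
    obtain \<epsilon> where \<epsilon>: "\<epsilon> > 0" "(\<Union>p\<in>K. cball p \<epsilon>) \<subseteq> UNIV \<times> J"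
      using compact_subset_open_imp_cball_epsilon_subset[OF K(1) D K(2)] by blast
    have w_smooth: "\<forall>\<^sub>F h in at_right 0. smooth_on (UNIV \<times> J) (w h)"
      and z_smooth: "\<forall>\<^sub>F h in at_right 0. smooth_on (UNIV \<times> J) (z h)"
      using wz_smooth by (auto elim: eventually_mono)
    note w_expands = expands_smooth_family[OF D K w_smooth w_bounds]
    note z_expands = expands_smooth_family[OF D K z_smooth z_bounds]
    obtain h1 h2 h3 h4 h5 where pos: "h1 > 0" "h2 > 0" "h3 > 0" "h4 > 0" "h5 > 0"
      and wx': "expands ({0<..<h1} \<times> K) (\<lambda>i s. w (fst i) (snd i + s *\<^sub>R (1, 0)))
        (\<lambda>i. w (fst i) (snd i)) (\<lambda>i. frechet_derivative (w (fst i)) (at (snd i)) (1, 0))"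
      and wt': "expands ({0<..<h2} \<times> K) (\<lambda>i s. w (fst i) (snd i + s *\<^sub>R (0, 1)))
        (\<lambda>i. w (fst i) (snd i)) (\<lambda>i. frechet_derivative (w (fst i)) (at (snd i)) (0, 1))"
      and zx': "expands ({0<..<h3} \<times> K) (\<lambda>i s. z (fst i) (snd i + s *\<^sub>R (1, 0)))
        (\<lambda>i. z (fst i) (snd i)) (\<lambda>i. frechet_derivative (z (fst i)) (at (snd i)) (1, 0))"
      and zt': "expands ({0<..<h4} \<times> K) (\<lambda>i s. z (fst i) (snd i + s *\<^sub>R (0, 1)))
        (\<lambda>i. z (fst i) (snd i)) (\<lambda>i. frechet_derivative (z (fst i)) (at (snd i)) (0, 1))"
      and h5: "\<And>h. 0 < h \<Longrightarrow> h < h5 \<Longrightarrow> smooth_on (UNIV \<times> J) (w h) \<and> smooth_on (UNIV \<times> J) (z h) \<and>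
        solves_time_marching lam f J h (w h) (z h)"
      using w_expands[of "(1, 0)"] w_expands[of "(0, 1)"] z_expands[of "(1, 0)"] z_expands[of "(0, 1)"]
        eventually_conj[OF wz_smooth algorithm] unfolding eventually_at_right_field by blast
    define H where "H = Min {h1, h2, h3, h4, h5, \<epsilon>}"
    have H: "H > 0" "H \<le> h1" "H \<le> h2" "H \<le> h3" "H \<le> h4" "H \<le> h5" "H \<le> \<epsilon>"
      using pos \<epsilon>(1) by (auto simp: H_def)
    \<comment> \<open>An index has the form \<open>(h, (x, t))\<close>, so
      \<open>fst (snd i)\<close> is the position and \<open>snd (snd i)\<close> the time.\<close>
    define I where "I = {0<..<H} \<times> K"
    have sub: "I \<subseteq> {0<..<h1} \<times> K" "I \<subseteq> {0<..<h2} \<times> K" "I \<subseteq> {0<..<h3} \<times> K" "I \<subseteq> {0<..<h4} \<times> K"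
      using H by (auto simp: I_def)
    let ?A = "\<lambda>i. frechet_derivative f (at (w (fst i) (snd i)))"
    let ?Dw = "\<lambda>i. frechet_derivative (w (fst i)) (at (snd i))"
    let ?Dz = "\<lambda>i. frechet_derivative (z (fst i)) (at (snd i))"
    let ?S = "\<lambda>i s. scheme2 lam f s (\<lambda>x. w (fst i) (x, snd (snd i)), \<lambda>x. z (fst i) (x, snd (snd i)))"
    have wx: "expands I (\<lambda>i s. w (fst i) (fst (snd i) + s, snd (snd i)))
        (\<lambda>i. w (fst i) (snd i)) (\<lambda>i. ?Dw i (1, 0))"
      using expands_subset[OF wx' sub(1)] by (simp add: plus_prod_def)
    have zx: "expands I (\<lambda>i s. z (fst i) (fst (snd i) + s, snd (snd i)))
        (\<lambda>i. z (fst i) (snd i)) (\<lambda>i. ?Dz i (1, 0))"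
      using expands_subset[OF zx' sub(3)] by (simp add: plus_prod_def)
    have wt: "expands I (\<lambda>i s. w (fst i) (fst (snd i), snd (snd i) + s))
        (\<lambda>i. w (fst i) (snd i)) (\<lambda>i. ?Dw i (0, 1))"
      using expands_subset[OF wt' sub(2)] by (simp add: plus_prod_def)
    have zt: "expands I (\<lambda>i s. z (fst i) (fst (snd i), snd (snd i) + s))
        (\<lambda>i. z (fst i) (snd i)) (\<lambda>i. ?Dz i (0, 1))"
      using expands_subset[OF zt' sub(4)] by (simp add: plus_prod_def)
    note scheme = expands_scheme2[OF lam f_smooth, where x = "\<lambda>i. fst (snd i)", OF wx zx]
    have march: "w h (x, t + h/2) - w h (x, t - h/2) = fst (?S i (h/2)) x - fst (?S i (- (h/2))) x"
      "z h (x, t + h/2) - z h (x, t - h/2) = snd (?S i (h/2)) x - snd (?S i (- (h/2))) x"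
      if "i \<in> I" "i = (h, x, t)" for i h x t
    proof -
      have h: "0 < h" "h < H" and p: "(x, t) \<in> K" using that by (auto simp: I_def)
      have "t + r \<in> J" if "\<bar>r\<bar> \<le> h" for r
      proof -
        have "(x, t + r) \<in> cball (x, t) \<epsilon>"
          using that h H(7) by (simp add: dist_Pair_Pair dist_norm)
        with p \<epsilon>(2) show ?thesis by blast
      qed
      from this[of "h/2"] this[of "- (h/2)"] this[of 0]
      have "t - h/2 \<in> J" "t \<in> J" "t + h/2 \<in> J" using h(1) by auto
      moreover have "solves_time_marching lam f J h (w h) (z h)" using h5[of h] h H(6) by auto
      ultimately show "w h (x, t + h/2) - w h (x, t - h/2) = fst (?S i (h/2)) x - fst (?S i (- (h/2))) x"
        "z h (x, t + h/2) - z h (x, t - h/2) = snd (?S i (h/2)) x - snd (?S i (- (h/2))) x"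
        unfolding solves_time_marching_def time_slice_def using h(1) that(2)
        by (auto simp: scaleR_cancel_left)
    qed
    obtain C1 d1 where 1: "0 \<le> C1" "0 < d1" "\<And>i. i \<in> I \<Longrightarrow> 0 < fst i \<Longrightarrow> fst i < d1 \<Longrightarrow>
        norm (?Dw i (0, 1) - - ?A i (?Dw i (1, 0))) \<le> C1 * (fst i)\<^sup>2"
      by (rule expands_equal_central_differences[OF wt scheme(1)]) (use march in auto)
    obtain C2 d2 where 2: "0 \<le> C2" "0 < d2" "\<And>i. i \<in> I \<Longrightarrow> 0 < fst i \<Longrightarrow> fst i < d2 \<Longrightarrow>
        norm (?Dz i (0, 1) - ?A i (?Dz i (1, 0) - 2 *\<^sub>R ?A i (?Dw i (1, 0)))) \<le> C2 * (fst i)\<^sup>2"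
      by (rule expands_equal_central_differences[OF zt scheme(2)]) (use march in auto)
    \<comment> \<open>The fields \<open>w h\<close> take values in one ball for all indices, so the
      derivative of \<open>f\<close> along them has a common bound \<open>M\<close>. It is needed
      because the defect of the \<open>w\<close> equation enters that of the \<open>y\<close>
      equation through \<open>?A i\<close>.\<close>
    obtain B where B: "\<And>i. i \<in> I \<Longrightarrow> norm (w (fst i) (snd i)) \<le> B"
      using wt by (rule expandsE) blast
    obtain M where M0: "M \<ge> 0" and M1: "\<And>u vs. u \<in> cball 0 B \<Longrightarrow> length vs = 1 \<Longrightarrow>
        norm (iter_deriv vs f u) \<le> M * prod_list (map norm vs)"
      using iter_deriv_bounded_on_compact[OF f_smooth, of "cball 0 B" 1] by auto
    have M: "norm (frechet_derivative f (at u) v) \<le> M * norm v" if "norm u \<le> B" for u v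
      using M1[of u "[v]"] that by simp
    have "norm (residual h p) \<le> (C1 + (C2 + M * C1)) * \<bar>h\<^sup>2\<bar>"
      if h: "0 < h" "h < Min {H, d1, d2}" and p: "p \<in> K" for h p
    proof -
      define i where "i = (h, p)"
      have i: "i \<in> I" "0 < fst i" "fst i < d1" "fst i < d2" using h p by (auto simp: I_def i_def)
      define a where "a = ?Dw i (0, 1) + ?A i (?Dw i (1, 0))"
      define b where "b = ?Dz i (0, 1) - ?A i (?Dz i (1, 0) - 2 *\<^sub>R ?A i (?Dw i (1, 0)))"
      have a: "norm a \<le> C1 * h\<^sup>2" using 1(3)[OF i(1-3)] by (simp add: a_def i_def)
      have b: "norm b \<le> C2 * h\<^sup>2" using 2(3)[OF i(1,2,4)] by (simp add: b_def i_def)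
      have "norm (?A i a) \<le> M * norm a" using M[OF B[OF i(1)]] .
      also have "\<dots> \<le> M * (C1 * h\<^sup>2)" using a M0 by (rule mult_left_mono)
      finally have Aa: "norm (?A i a) \<le> M * (C1 * h\<^sup>2)" .
      have "h < h5" "p \<in> UNIV \<times> J" using h H(6) p K(2) by auto
      with h5[OF h(1)] have "residual h p = stack a
        ((?Dz i (0, 1) - ?A i (?Dw i (0, 1))) - ?A i (?Dz i (1, 0) - ?A i (?Dw i (1, 0))))"
        unfolding residual_def a_def
        by (subst system_residual_flux_error[OF f_smooth, where D = "UNIV \<times> J"]) (auto simp: i_def)
      \<comment> \<open>The term \<open>2 A A w_x\<close> in \<open>b\<close> loses one copy of
        \<open>A A w_x\<close> to \<open>A a\<close>; the copy that remains completes
        \<open>A z_x\<close> to \<open>A y_x\<close>, while \<open>A w_t\<close> completes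
        \<open>z_t\<close> to \<open>y_t\<close>.\<close>
      also have "(?Dz i (0, 1) - ?A i (?Dw i (0, 1))) - ?A i (?Dz i (1, 0) - ?A i (?Dw i (1, 0)))
        = b - ?A i a"
        unfolding a_def b_def linear_add[OF lin] linear_diff[OF lin] linear_cmul[OF lin] scaleR_2
        by (simp add: algebra_simps)
      finally have "norm (residual h p) \<le> norm a + norm (b - ?A i a)"
        using norm_stack_le by metis
      also have "\<dots> \<le> C1 * h\<^sup>2 + (C2 * h\<^sup>2 + M * (C1 * h\<^sup>2))"
        by (intro add_mono a order_trans[OF norm_triangle_ineq4] b Aa)
      finally show ?thesis by (simp add: algebra_simps)
    qed
    moreover have "0 < Min {H, d1, d2}" using H(1) 1(2) 2(2) by simp
    ultimately show ?thesis unfolding eventually_at_right_field by blast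
  qed
  then show "locally_uniform_bigo (UNIV \<times> J) (\<lambda>h. system_residual (flux_error_matrix f)
      (\<lambda>p. stack (w h p) (flux_error f (w h) (z h) p))) (\<lambda>h. h\<^sup>2)"
    unfolding locally_uniform_bigo_def residual_def by blast
qed

end
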